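(* Let $T:\mathbb{R}\to\mathbb{R}_+$ be a function with $T(u)=o(\sqrt{u})$ as $u\to\infty$. Then, as $u\to\infty$, $$\mathbb{P}\left(\int_0^{T(u)} Q(r)\,\mathrm{d}r>u\right)=\exp\left(-\frac{2cu}{T(u)}-\frac{1}{3}c^2T(u)\right)(1+o(1)).$$
   Context: $\{B(t):t\in\mathbb{R}\}$ is a two-sided standard Brownian motion ($B(0)=0$, $\mathbb{E}B(t)=0$, $\mathrm{Var}\,B(t)=|t|$), and $c>0$ is a fixed constant. The stationary workload (Brownian storage) process is $Q(t)=\sup_{s\le t}\left(B(t)-B(s)-c(t-s)\right)$, $t\in\mathbb{R}$. Here $\mathbb{R}_+=(0,\infty)$. *)

theory Defs
  imports "HOL-Probability.Probability" "HOL-Library.Landau_Symbols"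
begin

locale two_sided_brownian_motion = prob_space M
  for M :: "'a measure" and B :: "real \<Rightarrow> 'a \<Rightarrow> real" +
  assumes random_variable_B: "\<And>t. random_variable borel (B t)"
    and B_zero: "AE \<omega> in M. B 0 \<omega> = 0"
    and continuous_paths: "\<And>\<omega>. \<omega> \<in> space M \<Longrightarrow> continuous_on UNIV (\<lambda>t. B t \<omega>)"
    and normal_increments: "\<And>s t. s < t \<Longrightarrow>
      distributed M lborel (\<lambda>\<omega>. B t \<omega> - B s \<omega>) (normal_density 0 (sqrt (t - s)))"
    and indep_increments: "\<And>(\<tau> :: nat \<Rightarrow> real) n. strict_mono \<tau> \<Longrightarrow>
      indep_vars (\<lambda>_. borel) (\<lambda>i \<omega>. B (\<tau> (Suc i)) \<omega> - B (\<tau> i) \<omega>) {..<n}"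

(* The supremum is taken in the reals. For Brownian B and c > 0, the set is bounded above for
   almost every \<omega>; on the exceptional null set it is unbounded for every t,
   and the value is irrelevant. *)
definition workload :: "(real \<Rightarrow> 'a \<Rightarrow> real) \<Rightarrow> real \<Rightarrow> real \<Rightarrow> 'a \<Rightarrow> real" where
  "workload B c t \<omega> = (SUP s\<in>{..t}. B t \<omega> - B s \<omega> - c * (t - s))"

end

(*
  Put f t = B t - c * t. As long as Q does not return to 0 on [0, T], Q t = f t - inf_{s <= 0} f s, and
  therefore int_0^T Q = int_0^T f - T * inf_{s <= 0} f s; in general the left-hand side is at least as
  large. If Q returns to 0, then int_0^T Q <= T * osc_{[0,T]} f, which exceeds u with a probability of
  order exp(-(u/T)^2 / (8 T)) only; this is negligible because T = o(sqrt u).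

  On a grid of mesh T/n, walk backwards in time from T, with steps of f weighted by 2c * min 1 ((k+1)/n).
  The partial sum at the grid time s <= 0 is 2c * ((Riemann mean of f over [0, T]) - f s), and from time 0
  on its exponential is a martingale. Optional stopping at the level b = 2cu/T hence gives the crossing
  probability exp(-b) * E exp(initial value) up to overshoot, and E exp(initial value) tends to
  exp(-c^2 T/3). Letting n tend to infinity,
    exp(-b - c^2 T/3) * (1 - exp(-b + c^2 T)) <= P(int_0^T Q > u)
      <= exp(-b - c^2 T/3) + 2 * exp(-(u/T - cT)^2 / (8 T)).
*)
theory Submission
  imports Defs "HOL-Real_Asymp.Real_Asymp"
begin

section \<open>Optional stopping for sums of independent variables\<close>

text \<open>Reading time backwards turns the starting point s of the supremum into the running index
  of a random walk, so that a supremum over the infinite past becomes a first-passage event. The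
  factor 2c is the Lundberg exponent for drift -c: it is the nonzero root of a^2/2 - a c. The upper
  bound is Markov's inequality for the stopped exponential. The obstacle is the lower bound: the
  mean of the stopped exponential is known exactly, but it must be shown that crossings with small
  overshoot carry it. Starts above b, large jumps and walks that have not crossed by the horizon are
  each controlled by an exponential moment of another order, namely 2, 1 + sqrt n and 1/2. T(u) may
  tend to 0, grow or oscillate, so no asymptotics in T are available. Hence n tends to infinity with
  u and T fixed, and the resulting inequalities are explicit in both.\<close>

primrec stopped_sum :: "nat \<Rightarrow> real \<Rightarrow> (nat \<Rightarrow> real) \<Rightarrow> nat \<Rightarrow> real" where
  "stopped_sum n b y 0 = 0"
| "stopped_sum n b y (Suc k) =
    (if n \<le> k \<and> b < stopped_sum n b y k then stopped_sum n b y k else stopped_sum n b y k + y k)"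

text \<open>The stopped sum depends on finitely many coordinates, which lets it factor through a
  product space and be independent of the next step.\<close>

lemma stopped_sum_restrict:
  "k \<le> m \<Longrightarrow> stopped_sum n b (restrict y {..<m}) k = stopped_sum n b y k"
  by (induction k) auto

lemma measurable_stopped_sum [measurable]:
  assumes "\<And>i. i < k \<Longrightarrow> (\<lambda>x. Y i x) \<in> borel_measurable N"
  shows "(\<lambda>x. stopped_sum n b (\<lambda>i. Y i x) k) \<in> borel_measurable N"
  using assms
proof (induction k)
  case (Suc k)
  have [measurable]: "(\<lambda>x. stopped_sum n b (\<lambda>i. Y i x) k) \<in> borel_measurable N"
    "Y k \<in> borel_measurable N"
    using Suc by auto
  show ?case
    unfolding stopped_sum.simps by measurable
qed simp

lemma stopped_sum_initial: "m \<le> n \<Longrightarrow> stopped_sum n b y m = sum y {..<m}"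
  by (induction m) auto

text \<open>A frozen value stays above b, so the terminal value alone records whether the level was
  exceeded at some index in the window. Indices below n are exempt: there the steps need not have
  exponential mean 1.\<close>

lemma stopped_sum_less_iff:
  assumes "n \<le> m"
  shows "b < stopped_sum n b y m \<longleftrightarrow> (\<exists>k\<in>{n..m}. b < sum y {..<k})"
    and "\<not> b < stopped_sum n b y m \<Longrightarrow> stopped_sum n b y m = sum y {..<m}"
proof -
  have "(b < stopped_sum n b y m \<longleftrightarrow> (\<exists>k\<in>{n..m}. b < sum y {..<k})) \<and>
      (\<not> b < stopped_sum n b y m \<longrightarrow> stopped_sum n b y m = sum y {..<m})"
    using assms
  proof (induction m rule: dec_induct)
    case base
    then show ?case by (simp add: stopped_sum_initial)
  next
    case (step m)
    have "{n..Suc m} = insert (Suc m) {n..m}"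
      using step.hyps by auto
    then show ?case
      using step by (cases "b < stopped_sum n b y m") auto
  qed
  then show "b < stopped_sum n b y m \<longleftrightarrow> (\<exists>k\<in>{n..m}. b < sum y {..<k})"
    and "\<not> b < stopped_sum n b y m \<Longrightarrow> stopped_sum n b y m = sum y {..<m}"
    by auto
qed

text \<open>The four terms account for a start above the barrier \<open>b\<close>, for a crossing with overshoot at most
  \<open>e\<close>, for a crossing by a step larger than \<open>e\<close>, and for no crossing at all. All but the second are
  replaced by Chernoff bounds, so that only exponential moments remain to be computed.\<close>
lemma exp_stopped_sum_le:
  fixes y :: "nat \<Rightarrow> real"
  assumes "n \<le> m" "p \<ge> 0"
  shows "exp (stopped_sum n b y m) \<le>
    exp (- b) * exp (2 * sum y {..<n})
    + exp (b + e) * indicator {y. \<exists>k\<in>{n..m}. b < sum y {..<k}} y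
    + (\<Sum>i\<in>{n..<m}. exp (b - p * e) * exp ((1 + p) * y i))
    + exp (b / 2) * exp (1 / 2 * sum y {..<m})"
    (is "_ \<le> ?A + ?B m + ?C m + ?D m")
proof (cases "b < stopped_sum n b y m")
  case False
  \<comment> \<open>Here the sum S is at most b, so one of the two factors in exp S = exp (S/2) *
    exp (S/2) is at most exp (b/2).\<close>
  have "exp (stopped_sum n b y m) \<le> ?D m"
    using False stopped_sum_less_iff(2)[OF assms(1) False]
    by (simp flip: exp_add)
  moreover have "?A \<ge> 0" "?B m \<ge> 0" "?C m \<ge> 0"
    by (auto intro!: sum_nonneg)
  ultimately show ?thesis by linarith
next
  case True
  have "exp (stopped_sum n b y m) \<le> ?A + ?B m + ?C m"
    using assms(1) True
  proof (induction m rule: dec_induct)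
    case base
    \<comment> \<open>Here S > b, hence S \<le> 2 S - b.\<close>
    have "exp (stopped_sum n b y n) \<le> ?A"
      using base by (simp add: stopped_sum_initial flip: exp_add)
    moreover have "?B n \<ge> 0" "?C n \<ge> 0"
      by (auto intro!: sum_nonneg)
    ultimately show ?case by linarith
  next
    case (step k)
    have [simp]: "{n..<Suc k} = insert k {n..<k}" "{n..Suc k} = insert (Suc k) {n..k}"
      using step.hyps by auto
    let ?t = "exp (b - p * e) * exp ((1 + p) * y k)"
    have mono: "?B k \<le> ?B (Suc k)" "?C (Suc k) = ?C k + ?t"
      by (auto simp: indicator_def)
    show ?case
    proof (cases "b < stopped_sum n b y k")
      case True
      then have "exp (stopped_sum n b y (Suc k)) = exp (stopped_sum n b y k)"
        using step.hyps by simp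
      moreover have "?t \<ge> 0" by simp
      ultimately show ?thesis
        using step.IH[OF True] mono by linarith
    next
      case False
      then have V: "stopped_sum n b y (Suc k) = stopped_sum n b y k + y k"
        by simp
      have nonneg: "?A \<ge> 0" "?B (Suc k) \<ge> 0" "?C k \<ge> 0" "?t \<ge> 0"
        by (auto intro!: sum_nonneg)
      show ?thesis
      proof (cases "y k \<le> e")
        case True
        have "?B (Suc k) = exp (b + e)"
          using step.prems stopped_sum_less_iff(1)[of n "Suc k" b y] step.hyps by simp
        moreover have "exp (stopped_sum n b y (Suc k)) \<le> exp (b + e)"
          using V True False by simp
        ultimately show ?thesis
          using nonneg mono by linarith
      next
        case overshoot: False
        \<comment> \<open>The sum before the step is at most b and the step exceeds e, so the
          nonnegative term p (y k - e) may be added to the exponent.\<close>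
        have "p * (y k - e) \<ge> 0"
          using overshoot assms(2) by simp
        then have "stopped_sum n b y (Suc k) \<le> b - p * e + (1 + p) * y k"
          using V False by (simp add: algebra_simps)
        then have "exp (stopped_sum n b y (Suc k)) \<le> ?t"
          by (simp flip: exp_add)
        then show ?thesis
          using nonneg mono by linarith
      qed
    qed
  qed
  moreover have "?D m \<ge> 0" by simp
  ultimately show ?thesis by linarith
qed

section \<open>Exponential means of the stopped sum and crossing probabilities\<close>

context prob_space
begin

lemma indep_var_nn_integral:
  fixes X Y :: "'a \<Rightarrow> ennreal"
  assumes "indep_var borel X borel Y"
  shows "(\<integral>\<^sup>+\<omega>. X \<omega> * Y \<omega> \<partial>M) = (\<integral>\<^sup>+\<omega>. X \<omega> \<partial>M) * (\<integral>\<^sup>+\<omega>. Y \<omega> \<partial>M)"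
proof -
  have "indep_vars (\<lambda>_. borel) (case_bool X Y) UNIV"
    using assms unfolding indep_var_def by (simp add: case_bool_if cong: if_cong)
  then have "(\<integral>\<^sup>+\<omega>. (\<Prod>i\<in>UNIV. case_bool X Y i \<omega>) \<partial>M) = (\<Prod>i\<in>UNIV. \<integral>\<^sup>+\<omega>. case_bool X Y i \<omega> \<partial>M)"
    by (intro indep_vars_nn_integral) auto
  then show ?thesis
    by (simp add: UNIV_bool mult.commute)
qed

text \<open>Reversal is a regrouping of the family into disjoint singleton blocks. It is needed
  because independence of increments is given along increasing times, while the walk runs
  backwards.\<close>

lemma indep_vars_rev:
  assumes "indep_vars (\<lambda>_. borel) X {..<N::nat}"
  shows "indep_vars (\<lambda>_. borel :: real measure) (\<lambda>i. X (N - Suc i)) {..<N}"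
proof (cases "N = 0")
  case False
  have "indep_vars (\<lambda>j. PiM {N - Suc j} (\<lambda>_. borel)) (\<lambda>j \<omega>. restrict (\<lambda>i. X i \<omega>) {N - Suc j}) {..<N}"
    using assms by (rule indep_vars_restrict) (auto simp: disjoint_family_on_def)
  then have "indep_vars (\<lambda>_. borel) (\<lambda>j \<omega>. (\<lambda>f. f (N - Suc j)) (restrict (\<lambda>i. X i \<omega>) {N - Suc j})) {..<N}"
    by (rule indep_vars_compose2) auto
  then show ?thesis by simp
qed (simp add: indep_vars_def2 indep_sets_def)

text \<open>Up to index n independence multiplies the means. Afterwards the mean stays constant:
  whether the walk is still running depends on earlier steps only, and the next step is an
  independent factor of mean 1. Nonnegative integrals avoid integrability questions.\<close>

lemma nn_integral_exp_stopped_sum: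
  fixes Y :: "nat \<Rightarrow> 'a \<Rightarrow> real"
  assumes ind: "indep_vars (\<lambda>_. borel) Y {..<N}"
    and one: "\<And>k. n \<le> k \<Longrightarrow> k < N \<Longrightarrow> (\<integral>\<^sup>+\<omega>. exp (Y k \<omega>) \<partial>M) = 1"
    and "n \<le> N"
  shows "(\<integral>\<^sup>+\<omega>. exp (stopped_sum n b (\<lambda>i. Y i \<omega>) N) \<partial>M) = (\<Prod>i<n. \<integral>\<^sup>+\<omega>. exp (Y i \<omega>) \<partial>M)"
proof -
  have rv [measurable]: "Y i \<in> borel_measurable M" if "i < N" for i
    using ind that by (auto simp: indep_vars_def)
  \<comment> \<open>Step k is independent of every nonnegative measurable functional of the steps
    before it.\<close>
  have split: "(\<integral>\<^sup>+\<omega>. F (restrict (\<lambda>i. Y i \<omega>) {..<k}) * ennreal (exp (Y k \<omega>)) \<partial>M) =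
      (\<integral>\<^sup>+\<omega>. F (restrict (\<lambda>i. Y i \<omega>) {..<k}) \<partial>M) * (\<integral>\<^sup>+\<omega>. ennreal (exp (Y k \<omega>)) \<partial>M)"
    if k: "k < N" and F: "F \<in> borel_measurable (PiM {..<k} (\<lambda>_. borel))" for k F
  proof -
    have "indep_var (PiM {..<k} (\<lambda>_. borel)) (\<lambda>\<omega>. restrict (\<lambda>i. Y i \<omega>) {..<k})
       (PiM {k} (\<lambda>_. borel)) (\<lambda>\<omega>. restrict (\<lambda>i. Y i \<omega>) {k})"
      using ind by (rule indep_var_restrict) (use k in auto)
    then have "indep_var borel (F \<circ> (\<lambda>\<omega>. restrict (\<lambda>i. Y i \<omega>) {..<k}))
        borel ((\<lambda>y. ennreal (exp (y k))) \<circ> (\<lambda>\<omega>. restrict (\<lambda>i. Y i \<omega>) {k}))"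
      by (rule indep_var_compose[OF _ F]) measurable
    then show ?thesis
      using indep_var_nn_integral by (fastforce simp: o_def)
  qed
  have meas: "(\<lambda>y. stopped_sum n b y k) \<in> borel_measurable (PiM {..<k} (\<lambda>_. borel))" for k
    by (rule measurable_stopped_sum[of k "\<lambda>i y. y i"]) auto
  define V where "V k \<omega> = stopped_sum n b (\<lambda>i. Y i \<omega>) k" for k \<omega>
  have V: "stopped_sum n b (restrict (\<lambda>i. Y i \<omega>) {..<k}) k = V k \<omega>" for k \<omega>
    unfolding V_def by (rule stopped_sum_restrict) simp
  have V_meas: "V k \<in> borel_measurable M" if "k \<le> N" for k
    unfolding V_def using that by (intro measurable_stopped_sum rv) auto
  have start: "(\<integral>\<^sup>+\<omega>. exp (V k \<omega>) \<partial>M) = (\<Prod>i<k. \<integral>\<^sup>+\<omega>. exp (Y i \<omega>) \<partial>M)" if "k \<le> n" for k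
    using that
  proof (induction k)
    case 0
    then show ?case by (simp add: V_def emeasure_space_1)
  next
    case (Suc k)
    have "(\<integral>\<^sup>+\<omega>. exp (V (Suc k) \<omega>) \<partial>M) = (\<integral>\<^sup>+\<omega>. ennreal (exp (V k \<omega>)) * exp (Y k \<omega>) \<partial>M)"
      using Suc.prems by (simp add: V_def exp_add ennreal_mult)
    also have "\<dots> = (\<integral>\<^sup>+\<omega>. ennreal (exp (V k \<omega>)) \<partial>M) * (\<integral>\<^sup>+\<omega>. exp (Y k \<omega>) \<partial>M)"
      using split[of k "\<lambda>y. ennreal (exp (stopped_sum n b y k))"] meas[of k] Suc.prems \<open>n \<le> N\<close>
      by (simp add: V)
    finally show ?case
      using Suc by (simp add: mult.commute)
  qed
  have "(\<integral>\<^sup>+\<omega>. exp (V k \<omega>) \<partial>M) = (\<Prod>i<n. \<integral>\<^sup>+\<omega>. exp (Y i \<omega>) \<partial>M)" if "n \<le> k" "k \<le> N" for k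
    using that
  proof (induction k rule: dec_induct)
    case base
    then show ?case by (simp add: start)
  next
    case (step k)
    then have k: "k < N" by simp
    note [measurable] = V_meas[OF less_imp_le[OF k]] rv[OF k]
    let ?F = "\<lambda>y. ennreal (exp (stopped_sum n b y k)) * indicator {y. \<not> b < stopped_sum n b y k} y"
    have F: "?F \<in> borel_measurable (PiM {..<k} (\<lambda>_. borel))"
    proof -
      note [measurable] = meas[of k]
      show ?thesis
        by (intro borel_measurable_times_ennreal borel_measurable_indicator') measurable
    qed
    have "(\<integral>\<^sup>+\<omega>. exp (V (Suc k) \<omega>) \<partial>M) =
        (\<integral>\<^sup>+\<omega>. ennreal (exp (V k \<omega>)) * indicator {\<omega>. b < V k \<omega>} \<omega>
          + ennreal (exp (V k \<omega>)) * indicator {\<omega>. \<not> b < V k \<omega>} \<omega> * exp (Y k \<omega>) \<partial>M)"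
      using step.hyps
      by (intro nn_integral_cong) (auto simp: V_def exp_add ennreal_mult indicator_def)
    also have "\<dots> = (\<integral>\<^sup>+\<omega>. ennreal (exp (V k \<omega>)) * indicator {\<omega>. b < V k \<omega>} \<omega> \<partial>M)
          + (\<integral>\<^sup>+\<omega>. ennreal (exp (V k \<omega>)) * indicator {\<omega>. \<not> b < V k \<omega>} \<omega> * exp (Y k \<omega>) \<partial>M)"
      by (intro nn_integral_add) (auto intro!: borel_measurable_times_ennreal borel_measurable_indicator')
    also have "(\<integral>\<^sup>+\<omega>. ennreal (exp (V k \<omega>)) * indicator {\<omega>. \<not> b < V k \<omega>} \<omega> * exp (Y k \<omega>) \<partial>M)
        = (\<integral>\<^sup>+\<omega>. ennreal (exp (V k \<omega>)) * indicator {\<omega>. \<not> b < V k \<omega>} \<omega> \<partial>M)"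
      using split[OF k F] one[OF step.hyps(1) k] by (simp add: V indicator_def)
    also have "(\<integral>\<^sup>+\<omega>. ennreal (exp (V k \<omega>)) * indicator {\<omega>. b < V k \<omega>} \<omega> \<partial>M) + \<dots>
        = (\<integral>\<^sup>+\<omega>. ennreal (exp (V k \<omega>)) * indicator {\<omega>. b < V k \<omega>} \<omega>
          + ennreal (exp (V k \<omega>)) * indicator {\<omega>. \<not> b < V k \<omega>} \<omega> \<partial>M)"
      by (intro nn_integral_add[symmetric]) (auto intro!: borel_measurable_times_ennreal borel_measurable_indicator')
    also have "\<dots> = (\<integral>\<^sup>+\<omega>. exp (V k \<omega>) \<partial>M)"
      by (intro nn_integral_cong) (auto simp: indicator_def)
    finally show ?case
      using step by simp
  qed
  then show ?thesis
    using assms(3) by (simp add: V_def)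
qed

lemma nn_integral_exp_sum:
  fixes Y :: "nat \<Rightarrow> 'a \<Rightarrow> real"
  assumes ind: "indep_vars (\<lambda>_. borel) Y {..<N}" and "n \<le> N"
  shows "(\<integral>\<^sup>+\<omega>. exp (q * (\<Sum>i<n. Y i \<omega>)) \<partial>M) = (\<Prod>i<n. \<integral>\<^sup>+\<omega>. exp (q * Y i \<omega>) \<partial>M)"
proof -
  have "indep_vars (\<lambda>_. borel) (\<lambda>i \<omega>. q * Y i \<omega>) {..<n}"
    by (rule indep_vars_compose2[OF indep_vars_subset[OF ind]]) (use assms in auto)
  \<comment> \<open>With freezing allowed only from the terminal index on, nothing is ever frozen;
    the barrier 0 is arbitrary.\<close>
  from nn_integral_exp_stopped_sum[OF this, of n 0] show ?thesis
    by (simp add: stopped_sum_initial sum_distrib_left)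
qed

text \<open>Markov's inequality: on a crossing the stopped sum exceeds b, and the mean of its
  exponential is exactly C.\<close>

lemma max_sum_upper_bound:
  fixes Y :: "nat \<Rightarrow> 'a \<Rightarrow> real"
  assumes ind: "indep_vars (\<lambda>_. borel) Y {..<N}"
    and one: "\<And>k. n \<le> k \<Longrightarrow> k < N \<Longrightarrow> (\<integral>\<^sup>+\<omega>. exp (Y k \<omega>) \<partial>M) = 1"
    and "n \<le> N"
    and init: "(\<Prod>i<n. \<integral>\<^sup>+\<omega>. exp (Y i \<omega>) \<partial>M) = ennreal C" "C \<ge> 0"
  shows "prob {\<omega>\<in>space M. \<exists>k\<in>{n..N}. b < (\<Sum>i<k. Y i \<omega>)} \<le> exp (- b) * C"
proof -
  have [measurable]: "Y i \<in> borel_measurable M" if "i < N" for i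
    using ind that by (auto simp: indep_vars_def)
  have [measurable]: "(\<lambda>\<omega>. stopped_sum n b (\<lambda>i. Y i \<omega>) N) \<in> borel_measurable M"
    by measurable
  let ?A = "{\<omega>\<in>space M. b < stopped_sum n b (\<lambda>i. Y i \<omega>) N}"
  have "emeasure M ?A = (\<integral>\<^sup>+\<omega>. indicator ?A \<omega> \<partial>M)"
    by simp
  also have "\<dots> \<le> (\<integral>\<^sup>+\<omega>. ennreal (exp (-b)) * exp (stopped_sum n b (\<lambda>i. Y i \<omega>) N) \<partial>M)"
    by (intro nn_integral_mono)
       (auto simp: indicator_def simp flip: ennreal_mult exp_add ennreal_1)
  also have "\<dots> = ennreal (exp (-b) * C)"
    using init by (simp add: nn_integral_cmult nn_integral_exp_stopped_sum[OF ind one \<open>n \<le> N\<close>] ennreal_mult)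
  finally have "prob ?A \<le> exp (-b) * C"
    using init(2) by (simp add: emeasure_eq_measure)
  then show ?thesis
    using stopped_sum_less_iff(1)[OF \<open>n \<le> N\<close>] by simp
qed

text \<open>The mean of the stopped exponential is exactly C1, and integrating the pointwise bound
  of \<open>exp_stopped_sum_le\<close> distributes it over the four scenarios. Solved for the
  probability, this is the converse of \<open>max_sum_upper_bound\<close> up to three error
  terms.\<close>

lemma max_sum_lower_bound:
  fixes Y :: "nat \<Rightarrow> 'a \<Rightarrow> real"
  assumes ind: "indep_vars (\<lambda>_. borel) Y {..<N}"
    and one: "\<And>k. n \<le> k \<Longrightarrow> k < N \<Longrightarrow> (\<integral>\<^sup>+\<omega>. exp (Y k \<omega>) \<partial>M) = 1"
    and "n \<le> N" "p \<ge> 0"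
    and init: "(\<Prod>i<n. \<integral>\<^sup>+\<omega>. exp (Y i \<omega>) \<partial>M) = ennreal C1" "C1 \<ge> 0"
    and init2: "(\<Prod>i<n. \<integral>\<^sup>+\<omega>. exp (2 * Y i \<omega>) \<partial>M) = ennreal C2" "C2 \<ge> 0"
    and jump: "\<And>k. n \<le> k \<Longrightarrow> k < N \<Longrightarrow> (\<integral>\<^sup>+\<omega>. exp ((1 + p) * Y k \<omega>) \<partial>M) = ennreal J" "J \<ge> 0"
    and half: "(\<Prod>i<N. \<integral>\<^sup>+\<omega>. exp (1 / 2 * Y i \<omega>) \<partial>M) = ennreal H" "H \<ge> 0"
  shows "C1 \<le> exp (- b) * C2
    + exp (b + e) * prob {\<omega>\<in>space M. \<exists>k\<in>{n..N}. b < (\<Sum>i<k. Y i \<omega>)}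
    + real (N - n) * exp (b - p * e) * J + exp (b / 2) * H"
proof -
  have rv [measurable]: "Y i \<in> borel_measurable M" if "i < N" for i
    using ind that by (auto simp: indep_vars_def)
  let ?A = "{\<omega>\<in>space M. \<exists>k\<in>{n..N}. b < (\<Sum>i<k. Y i \<omega>)}"
  have sum_meas: "(\<lambda>\<omega>. \<Sum>i<k. Y i \<omega>) \<in> borel_measurable M" if "k \<le> N" for k
    using that by (intro borel_measurable_sum rv) auto
  have "?A = (\<Union>k\<in>{n..N}. {\<omega>\<in>space M. b < (\<Sum>i<k. Y i \<omega>)})"
    by auto
  also have "\<dots> \<in> sets M"
    by (intro sets.finite_UN borel_measurable_less) (auto intro: sum_meas)
  finally have A [measurable]: "?A \<in> sets M" .
  note [measurable] = sum_meas[OF \<open>n \<le> N\<close>] sum_meas[OF order_refl]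
  have "ennreal C1 = (\<integral>\<^sup>+\<omega>. exp (stopped_sum n b (\<lambda>i. Y i \<omega>) N) \<partial>M)"
    using nn_integral_exp_stopped_sum[OF ind one \<open>n \<le> N\<close>] init by simp
  also have "\<dots> \<le> (\<integral>\<^sup>+\<omega>. ennreal (exp (- b)) * exp (2 * (\<Sum>i<n. Y i \<omega>))
    + ennreal (exp (b + e)) * indicator ?A \<omega>
    + (\<Sum>i\<in>{n..<N}. ennreal (exp (b - p * e)) * exp ((1 + p) * Y i \<omega>))
    + ennreal (exp (b / 2)) * exp (1 / 2 * (\<Sum>i<N. Y i \<omega>)) \<partial>M)"
  proof (intro nn_integral_mono)
    fix \<omega> assume "\<omega> \<in> space M"
    then have ind_eq: "indicator ?A \<omega> = ennreal (indicator {y. \<exists>k\<in>{n..N}. b < sum y {..<k}} (\<lambda>i. Y i \<omega>))"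
      by (simp add: indicator_def)
    show "ennreal (exp (stopped_sum n b (\<lambda>i. Y i \<omega>) N))
      \<le> ennreal (exp (- b)) * exp (2 * (\<Sum>i<n. Y i \<omega>))
    + ennreal (exp (b + e)) * indicator ?A \<omega>
    + (\<Sum>i\<in>{n..<N}. ennreal (exp (b - p * e)) * exp ((1 + p) * Y i \<omega>))
    + ennreal (exp (b / 2)) * exp (1 / 2 * (\<Sum>i<N. Y i \<omega>))"
      unfolding ind_eq
      using exp_stopped_sum_le[OF \<open>n \<le> N\<close> \<open>p \<ge> 0\<close>, of b "\<lambda>i. Y i \<omega>" e]
      by (simp add: sum_nonneg ennreal_leI flip: ennreal_mult ennreal_plus)
  qed
  also have "\<dots> = (\<integral>\<^sup>+\<omega>. ennreal (exp (- b)) * exp (2 * (\<Sum>i<n. Y i \<omega>)) \<partial>M)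
    + (\<integral>\<^sup>+\<omega>. ennreal (exp (b + e)) * indicator ?A \<omega> \<partial>M)
    + (\<integral>\<^sup>+\<omega>. (\<Sum>i\<in>{n..<N}. ennreal (exp (b - p * e)) * exp ((1 + p) * Y i \<omega>)) \<partial>M)
    + (\<integral>\<^sup>+\<omega>. ennreal (exp (b / 2)) * exp (1 / 2 * (\<Sum>i<N. Y i \<omega>)) \<partial>M)"
    by (simp add: nn_integral_add)
  also have "(\<integral>\<^sup>+\<omega>. (\<Sum>i\<in>{n..<N}. ennreal (exp (b - p * e)) * exp ((1 + p) * Y i \<omega>)) \<partial>M)
      = (\<Sum>i\<in>{n..<N}. \<integral>\<^sup>+\<omega>. ennreal (exp (b - p * e)) * exp ((1 + p) * Y i \<omega>) \<partial>M)"
    by (intro nn_integral_sum) simp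
  also have "\<dots> = (\<Sum>i\<in>{n..<N}. ennreal (exp (b - p * e)) * ennreal J)"
    by (intro sum.cong refl) (simp add: nn_integral_cmult jump)
  also have "\<dots> = ennreal (real (N - n) * exp (b - p * e) * J)"
    using jump(2) by (simp add: ennreal_mult ennreal_of_nat_eq_real_of_nat mult.assoc)
  also have "(\<integral>\<^sup>+\<omega>. ennreal (exp (- b)) * exp (2 * (\<Sum>i<n. Y i \<omega>)) \<partial>M) = ennreal (exp (- b) * C2)"
    using nn_integral_exp_sum[OF ind \<open>n \<le> N\<close>, of 2] init2
    by (simp add: nn_integral_cmult ennreal_mult)
  also have "(\<integral>\<^sup>+\<omega>. ennreal (exp (b / 2)) * exp (1 / 2 * (\<Sum>i<N. Y i \<omega>)) \<partial>M) = ennreal (exp (b / 2) * H)"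
    using nn_integral_exp_sum[OF ind order_refl, of "1/2"] half
    by (simp add: nn_integral_cmult ennreal_mult)
  also have "(\<integral>\<^sup>+\<omega>. ennreal (exp (b + e)) * indicator ?A \<omega> \<partial>M) = ennreal (exp (b + e) * prob ?A)"
    by (simp add: nn_integral_cmult emeasure_eq_measure ennreal_mult)
  finally show ?thesis
    using init2(2) jump(2) half(2)
    by (simp del: ennreal_plus flip: ennreal_plus)
qed

end

lemma nn_integral_exp_normal:
  assumes "distributed M lborel X (normal_density 0 \<sigma>)" "\<sigma> > 0"
  shows "(\<integral>\<^sup>+\<omega>. exp (a * X \<omega> + d) \<partial>M) = exp (a\<^sup>2 * \<sigma>\<^sup>2 / 2 + d)"
proof -
  have "(\<integral>\<^sup>+\<omega>. exp (a * X \<omega> + d) \<partial>M) = (\<integral>\<^sup>+x. normal_density 0 \<sigma> x * ennreal (exp (a * x + d)) \<partial>lborel)"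
    using distributed_nn_integral[OF assms(1), of "\<lambda>x. ennreal (exp (a * x + d))"] by simp
  also have "\<dots> = (\<integral>\<^sup>+x. ennreal (exp (a\<^sup>2 * \<sigma>\<^sup>2 / 2 + d)) * ennreal (normal_density (a * \<sigma>\<^sup>2) \<sigma> x) \<partial>lborel)"
  proof (intro nn_integral_cong)
    fix x :: real
    \<comment> \<open>Completing the square: the exponential tilt moves the mean of the density to a
      \<sigma>^2.\<close>
    have "- x\<^sup>2 / (2 * \<sigma>\<^sup>2) + (a * x + d) = a\<^sup>2 * \<sigma>\<^sup>2 / 2 + d + - (x - a * \<sigma>\<^sup>2)\<^sup>2 / (2 * \<sigma>\<^sup>2)"
      using assms(2) by (simp add: field_simps power2_eq_square)
    then have "normal_density 0 \<sigma> x * exp (a * x + d) = exp (a\<^sup>2 * \<sigma>\<^sup>2 / 2 + d) * normal_density (a * \<sigma>\<^sup>2) \<sigma> x"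
      unfolding normal_density_def by (simp add: field_simps flip: exp_add)
    then show "normal_density 0 \<sigma> x * ennreal (exp (a * x + d)) =
        ennreal (exp (a\<^sup>2 * \<sigma>\<^sup>2 / 2 + d)) * ennreal (normal_density (a * \<sigma>\<^sup>2) \<sigma> x)"
      by (simp flip: ennreal_mult)
  qed
  also have "\<dots> = ennreal (exp (a\<^sup>2 * \<sigma>\<^sup>2 / 2 + d))"
    using assms(2) by (simp add: nn_integral_cmult nn_integral_eq_integral)
  finally show ?thesis .
qed

section \<open>Brownian motion on a grid\<close>

text \<open>Summation by parts: consecutive weights differ by 1/n until they reach 1, which puts 1/n
  on each of the first n values, and then stay constant, which only telescopes.\<close>

lemma sum_ramp_weights:
  fixes g :: "nat \<Rightarrow> real" and n :: nat
  assumes "n > 0" "n \<le> m"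
  shows "(\<Sum>k<m. min 1 (real (Suc k) / n) * (g k - g (Suc k))) = (\<Sum>k<n. g k) / n - g m"
proof -
  have "(\<Sum>k<m. min 1 (real (Suc k) / n) * (g k - g (Suc k))) = ((\<Sum>k<m. g k) - m * g m) / n"
    if "m \<le> n" for m
    using that
  proof (induction m)
    case (Suc m)
    then have "min 1 (real (Suc m) / n) = real (Suc m) / n"
      by simp
    then show ?case
      using Suc assms(1) by (simp add: field_simps)
  qed simp
  note start = this[OF order_refl]
  show ?thesis
    using assms(2)
  proof (induction m rule: dec_induct)
    case base
    then show ?case
      unfolding start using assms(1) by (simp add: diff_divide_distrib)
  next
    case (step m)
    then have "min 1 (real (Suc m) / n) = 1"
      using assms(1) by simp
    then show ?case
      using step by simp
  qed
qed

lemma sum_Suc_squares: "(\<Sum>k<n. (real (Suc k))\<^sup>2) = n * (n + 1) * (2 * n + 1) / 6"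
  by (induction n) (simp_all add: field_simps power2_eq_square)

lemma sum_Suc: "(\<Sum>k<n. real (Suc k)) = n * (n + 1) / 2"
  by (induction n) (simp_all add: field_simps)

definition drifted :: "(real \<Rightarrow> 'a \<Rightarrow> real) \<Rightarrow> real \<Rightarrow> 'a \<Rightarrow> real \<Rightarrow> real" where
  "drifted B c \<omega> t = B t \<omega> - c * t"

text \<open>The product of the \<open>q\<close>-th exponential moments of the \<open>n\<close> backward steps that cover \<open>[0, T]\<close>.\<close>
definition ramp_mgf :: "real \<Rightarrow> real \<Rightarrow> nat \<Rightarrow> real \<Rightarrow> real" where
  "ramp_mgf c T n q =
    exp (2 * c\<^sup>2 * T * (q\<^sup>2 * ((real n + 1) * (2 * real n + 1) / (6 * (real n)\<^sup>2)) - q * ((real n + 1) / (2 * real n))))"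

section \<open>Brownian increments, maximal inequality and the backward walk\<close>

context two_sided_brownian_motion
begin

lemma indep_grid_increments:
  assumes "h > 0"
  shows "indep_vars (\<lambda>_. borel) (\<lambda>i \<omega>. B (s + real (Suc i) * h) \<omega> - B (s + real i * h) \<omega>) {..<N::nat}"
  using assms by (intro indep_increments) (auto simp: strict_mono_def)

lemma indep_reversed_increments:
  assumes "h > 0"
  shows "indep_vars (\<lambda>_. borel) (\<lambda>i \<omega>. B (t - real i * h) \<omega> - B (t - real (Suc i) * h) \<omega>) {..<N::nat}"
proof -
  \<comment> \<open>A forward grid that starts at t - N h ends at t, so its reversal starts at
    t.\<close>
  have "indep_vars (\<lambda>_. borel) (\<lambda>i \<omega>. B (t - real N * h + real (Suc (N - Suc i)) * h) \<omega>
      - B (t - real N * h + real (N - Suc i) * h) \<omega>) {..<N::nat}"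
    using indep_vars_rev[OF indep_grid_increments[OF assms, of "t - real N * h" N]] .
  moreover have "t - real N * h + real (Suc (N - Suc i)) * h = t - real i * h"
    "t - real N * h + real (N - Suc i) * h = t - real (Suc i) * h" if "i < N" for i
  proof -
    have "real (N - Suc i) = real N - real (Suc i)"
      using that by simp
    then show "t - real N * h + real (N - Suc i) * h = t - real (Suc i) * h"
      "t - real N * h + real (Suc (N - Suc i)) * h = t - real i * h"
      by (simp_all add: algebra_simps)
  qed
  ultimately show ?thesis
    by (subst indep_vars_cong[OF refl _ refl, where Y = "\<lambda>i \<omega>. B (t - real N * h + real (Suc (N - Suc i)) * h) \<omega>
      - B (t - real N * h + real (N - Suc i) * h) \<omega>"]) (simp_all only: lessThan_iff)
qed

lemma nn_integral_exp_increment: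
  assumes "s < t"
  shows "(\<integral>\<^sup>+\<omega>. exp (a * (B t \<omega> - B s \<omega>) + d) \<partial>M) = exp (a\<^sup>2 * (t - s) / 2 + d)"
  using nn_integral_exp_normal[OF normal_increments[OF assms], of a d] assms by simp

text \<open>The maximal inequality for the exponential martingale of \<theta> \<sigma> B with
  correction \<theta>^2 t / 2. The choice \<theta> = r / T maximizes \<theta> r - \<theta>^2 T / 2,
  with value r^2 / (2 T). The sign \<sigma> covers maximum and minimum at once.\<close>

lemma grid_range_bound:
  fixes n :: nat
  assumes "r > 0" "T > 0" "n > 0" "\<bar>\<sigma>\<bar> = 1"
  shows "prob {\<omega>\<in>space M. \<exists>k\<le>n. r < \<sigma> * (B (real k * (T / n)) \<omega> - B 0 \<omega>)} \<le> exp (- (r\<^sup>2 / (2 * T)))"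
proof -
  define \<theta> where "\<theta> = r / T"
  define h where "h = T / n"
  have h: "h > 0" "n * h = T"
    using assms by (simp_all add: h_def)
  define Y where "Y i \<omega> = \<theta> * \<sigma> * (B (real (Suc i) * h) \<omega> - B (real i * h) \<omega>) + (- \<theta>\<^sup>2 * h / 2)" for i \<omega>
  have \<sigma>: "\<sigma>\<^sup>2 = 1"
    using assms(4) by (metis power2_abs one_power2)
  have ind: "indep_vars (\<lambda>_. borel) Y {..<n}"
    using indep_vars_compose2[OF indep_grid_increments[OF h(1), of 0 n],
        of "\<lambda>i x. \<theta> * \<sigma> * x + (- \<theta>\<^sup>2 * h / 2)" "\<lambda>_. borel"]
    by (simp add: Y_def[abs_def])
  have one: "(\<integral>\<^sup>+\<omega>. exp (Y k \<omega>) \<partial>M) = 1" for k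
  proof -
    have "real k * h < real (Suc k) * h"
      using h by simp
    then have "(\<integral>\<^sup>+\<omega>. exp (Y k \<omega>) \<partial>M)
        = exp ((\<theta> * \<sigma>)\<^sup>2 * (real (Suc k) * h - real k * h) / 2 + (- \<theta>\<^sup>2 * h / 2))"
      unfolding Y_def by (rule nn_integral_exp_increment)
    also have "(\<theta> * \<sigma>)\<^sup>2 * (real (Suc k) * h - real k * h) / 2 + (- \<theta>\<^sup>2 * h / 2) = 0"
      by (simp add: power_mult_distrib \<sigma> algebra_simps)
    finally show ?thesis by simp
  qed
  have sum_Y: "(\<Sum>i<k. Y i \<omega>) = \<theta> * \<sigma> * (B (real k * h) \<omega> - B 0 \<omega>) - \<theta>\<^sup>2 * (real k * h) / 2" for k \<omega>
  proof (induction k)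
    case (Suc k)
    show ?case
      unfolding sum.lessThan_Suc Suc by (simp add: Y_def field_simps)
  qed simp
  have [measurable]: "B t \<in> borel_measurable M" for t
    by (rule random_variable_B)
  have "prob {\<omega>\<in>space M. \<exists>k\<le>n. r < \<sigma> * (B (real k * h) \<omega> - B 0 \<omega>)}
      \<le> prob {\<omega>\<in>space M. \<exists>k\<in>{0..n}. r\<^sup>2 / (2 * T) < (\<Sum>i<k. Y i \<omega>)}"
  proof (intro finite_measure_mono subsetI)
    fix \<omega> assume "\<omega> \<in> {\<omega>\<in>space M. \<exists>k\<le>n. r < \<sigma> * (B (real k * h) \<omega> - B 0 \<omega>)}"
    then obtain k where k: "\<omega> \<in> space M" "k \<le> n" "r < \<sigma> * (B (real k * h) \<omega> - B 0 \<omega>)"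
      by auto
    have "real k * h \<le> T"
      using k(2) h by (metis mult_right_mono of_nat_le_iff less_imp_le)
    then have "\<theta>\<^sup>2 * (real k * h) / 2 \<le> \<theta>\<^sup>2 * T / 2"
      by (intro divide_right_mono mult_left_mono) auto
    moreover have "\<theta> * r < \<theta> * (\<sigma> * (B (real k * h) \<omega> - B 0 \<omega>))"
      using k(3) assms by (intro mult_strict_left_mono) (auto simp: \<theta>_def)
    moreover have "r\<^sup>2 / (2 * T) = \<theta> * r - \<theta>\<^sup>2 * T / 2"
      using assms by (simp add: \<theta>_def field_simps power2_eq_square)
    ultimately have "r\<^sup>2 / (2 * T) < (\<Sum>i<k. Y i \<omega>)"
      unfolding sum_Y by (simp add: mult.assoc)
    then show "\<omega> \<in> {\<omega>\<in>space M. \<exists>k\<in>{0..n}. r\<^sup>2 / (2 * T) < (\<Sum>i<k. Y i \<omega>)}"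
      using k by auto
  qed (simp add: sum_Y)
  also have "\<dots> \<le> exp (- (r\<^sup>2 / (2 * T))) * 1"
    using ind one by (intro max_sum_upper_bound) auto
  finally show ?thesis by (simp add: h_def)
qed

text \<open>The steps run backwards in time from \<open>T\<close>. On \<open>[0, T]\<close> their weights increase linearly,
  which turns the partial sums into Riemann sums of the drifted path.\<close>
definition backward_step :: "real \<Rightarrow> real \<Rightarrow> nat \<Rightarrow> nat \<Rightarrow> 'a \<Rightarrow> real" where
  "backward_step c T n k \<omega> = 2 * c * min 1 (real (Suc k) / n) *
    (drifted B c \<omega> (T - real k * (T / n)) - drifted B c \<omega> (T - real (Suc k) * (T / n)))"

text \<open>With n^2 past cells of width T/n the grid reaches back to -nT, so that a single limit in
  n both refines the mesh and exhausts the past.\<close>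

definition grid_event :: "real \<Rightarrow> real \<Rightarrow> nat \<Rightarrow> real \<Rightarrow> 'a set" where
  "grid_event c T n u = {\<omega>\<in>space M. \<exists>j\<le>n\<^sup>2.
    u < T * ((\<Sum>k<n. drifted B c \<omega> (T - real k * (T / n))) / n - drifted B c \<omega> (- (real j * (T / n))))}"

lemma indep_backward_step:
  fixes n :: nat
  assumes "T > 0" "n > 0"
  shows "indep_vars (\<lambda>_. borel) (backward_step c T n) {..<N}"
proof -
  have "backward_step c T n = (\<lambda>k \<omega>. (\<lambda>x. 2 * c * min 1 (real (Suc k) / n) * (x - c * (T / n)))
      (B (T - real k * (T / n)) \<omega> - B (T - real (Suc k) * (T / n)) \<omega>))"
    by (simp add: fun_eq_iff backward_step_def drifted_def algebra_simps add_divide_distrib)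
  moreover have "indep_vars (\<lambda>_. borel) (\<lambda>k \<omega>. (\<lambda>x. 2 * c * min 1 (real (Suc k) / n) * (x - c * (T / n)))
      (B (T - real k * (T / n)) \<omega> - B (T - real (Suc k) * (T / n)) \<omega>)) {..<N}"
    by (rule indep_vars_compose2[OF indep_reversed_increments]) (use assms in auto)
  ultimately show ?thesis by simp
qed

lemma nn_integral_exp_backward_step:
  fixes n k :: nat
  assumes "T > 0" "n > 0" and a: "a = 2 * c * min 1 (real (Suc k) / n)"
  shows "(\<integral>\<^sup>+\<omega>. exp (q * backward_step c T n k \<omega>) \<partial>M) = exp (q\<^sup>2 * a\<^sup>2 * (T / n) / 2 - q * a * c * (T / n))"
proof -
  define h where "h = T / n"
  have h: "h > 0"
    using assms by (simp add: h_def)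
  have "q * backward_step c T n k \<omega> =
      q * a * (B (T - real k * h) \<omega> - B (T - real (Suc k) * h) \<omega>) + - (q * a * c * h)" for \<omega>
    by (simp add: backward_step_def drifted_def h_def a algebra_simps add_divide_distrib)
  moreover have "T - real (Suc k) * h < T - real k * h"
    using h by simp
  ultimately have "(\<integral>\<^sup>+\<omega>. exp (q * backward_step c T n k \<omega>) \<partial>M)
      = exp ((q * a)\<^sup>2 * (T - real k * h - (T - real (Suc k) * h)) / 2 + - (q * a * c * h))"
    by (simp only: nn_integral_exp_increment)
  then show ?thesis
    by (simp add: power_mult_distrib algebra_simps add_divide_distrib h_def)
qed

text \<open>The exponent vanishes at q = 1, which is the martingale property; it is negative at q =
  1/2, which makes a long walk without a crossing unlikely.\<close>

lemma nn_integral_exp_backward_step_past: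
  fixes n k :: nat
  assumes "T > 0" "n > 0" "n \<le> k"
  shows "(\<integral>\<^sup>+\<omega>. exp (q * backward_step c T n k \<omega>) \<partial>M) = exp (2 * c\<^sup>2 * (T / n) * (q\<^sup>2 - q))"
proof -
  have "min 1 (real (Suc k) / n) = 1"
    using assms by simp
  then show ?thesis
    unfolding nn_integral_exp_backward_step[OF assms(1,2) refl]
    by (simp add: power2_eq_square algebra_simps diff_divide_distrib)
qed

lemma prod_exp_backward_step:
  assumes "T > 0" "n > 0"
  shows "(\<Prod>k<n. \<integral>\<^sup>+\<omega>. exp (q * backward_step c T n k \<omega>) \<partial>M) = ramp_mgf c T n q"
proof -
  let ?a = "\<lambda>k. 2 * c * (real (Suc k) / n)"
  have "(\<Prod>k<n. \<integral>\<^sup>+\<omega>. exp (q * backward_step c T n k \<omega>) \<partial>M)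
      = (\<Prod>k<n. ennreal (exp (q\<^sup>2 * (?a k)\<^sup>2 * (T / n) / 2 - q * ?a k * c * (T / n))))"
    by (intro prod.cong refl nn_integral_exp_backward_step assms) simp
  also have "\<dots> = exp (\<Sum>k<n. q\<^sup>2 * (?a k)\<^sup>2 * (T / n) / 2 - q * ?a k * c * (T / n))"
    by (simp add: prod_ennreal exp_sum)
  also have "(\<Sum>k<n. q\<^sup>2 * (?a k)\<^sup>2 * (T / n) / 2 - q * ?a k * c * (T / n))
      = (\<Sum>k<n. 2 * q\<^sup>2 * c\<^sup>2 * T / n ^ 3 * (real (Suc k))\<^sup>2 - 2 * q * c\<^sup>2 * T / n\<^sup>2 * real (Suc k))"
    using assms(2)
    by (intro sum.cong refl) (simp add: field_simps power2_eq_square power3_eq_cube)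
  also have "\<dots> = 2 * q\<^sup>2 * c\<^sup>2 * T / n ^ 3 * (\<Sum>k<n. (real (Suc k))\<^sup>2)
       - 2 * q * c\<^sup>2 * T / n\<^sup>2 * (\<Sum>k<n. real (Suc k))"
    by (simp only: sum_subtractf sum_distrib_left)
  also have "\<dots> = 2 * c\<^sup>2 * T * (q\<^sup>2 * ((real n + 1) * (2 * real n + 1) / (6 * (real n)\<^sup>2)) - q * ((real n + 1) / (2 * real n)))"
    unfolding sum_Suc_squares sum_Suc using assms(2)
    by (simp add: divide_simps power2_eq_square power3_eq_cube) (simp add: algebra_simps)
  finally show ?thesis
    by (simp add: ramp_mgf_def)
qed

text \<open>After n + j steps the walk has reached time -jT/n, and scaling by 2c/T turns the level u
  into b.\<close>

lemma grid_event_eq: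
  assumes "T > 0" "n > 0" "c > 0"
  shows "grid_event c T n u =
    {\<omega>\<in>space M. \<exists>k\<in>{n..n + n\<^sup>2}. 2 * c * u / T < (\<Sum>i<k. backward_step c T n i \<omega>)}"
proof -
  let ?A = "\<lambda>\<omega>. (\<Sum>k<n. drifted B c \<omega> (T - real k * (T / n))) / n"
  have sum_eq: "(\<Sum>i<n + j. backward_step c T n i \<omega>) = 2 * c * (?A \<omega> - drifted B c \<omega> (- (real j * (T / n))))" for j \<omega>
  proof -
    have "(\<Sum>i<n + j. backward_step c T n i \<omega>) = 2 * c *
       (\<Sum>i<n + j. min 1 (real (Suc i) / n) * (drifted B c \<omega> (T - real i * (T / n)) - drifted B c \<omega> (T - real (Suc i) * (T / n))))"
      unfolding backward_step_def by (simp only: sum_distrib_left mult.assoc)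
    also have "\<dots> = 2 * c * (?A \<omega> - drifted B c \<omega> (T - real (n + j) * (T / n)))"
      by (subst sum_ramp_weights[where g = "\<lambda>i. drifted B c \<omega> (T - real i * (T / n))"]) (use assms in auto)
    also have "T - real (n + j) * (T / n) = - (real j * (T / n))"
      using assms(2) by (simp add: field_simps)
    finally show ?thesis .
  qed
  have "2 * c * u / T < 2 * c * x \<longleftrightarrow> u < T * x" for x
    using assms by (simp add: field_simps)
  then have "2 * c * u / T < (\<Sum>i<n + j. backward_step c T n i \<omega>) \<longleftrightarrow>
     u < T * (?A \<omega> - drifted B c \<omega> (- (real j * (T / n))))" for j \<omega>
    by (simp only: sum_eq)
  moreover have "(\<exists>k\<in>{n..n + n\<^sup>2}. P k) \<longleftrightarrow> (\<exists>j\<le>n\<^sup>2. P (n + j))" for P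
    by (metis add_le_cancel_left atLeastAtMost_iff le_add1 le_add_diff_inverse)
  ultimately show ?thesis
    by (simp add: grid_event_def)
qed

lemma sets_grid_event [measurable]: "grid_event c T n u \<in> sets M"
proof -
  have [measurable]: "B t \<in> borel_measurable M" for t
    by (rule random_variable_B)
  show ?thesis
    unfolding grid_event_def drifted_def by measurable
qed

lemma grid_event_upper:
  assumes "T > 0" "n > 0" "c > 0"
  shows "prob (grid_event c T n u) \<le> exp (- (2 * c * u / T)) * ramp_mgf c T n 1"
  unfolding grid_event_eq[OF assms]
proof (rule max_sum_upper_bound)
  show "indep_vars (\<lambda>_. borel) (backward_step c T n) {..<n + n\<^sup>2}"
    using assms by (intro indep_backward_step)
  show "(\<integral>\<^sup>+\<omega>. exp (backward_step c T n k \<omega>) \<partial>M) = 1" if "n \<le> k" for k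
    using nn_integral_exp_backward_step_past[OF assms(1,2) that, of 1 c] by simp
  show "(\<Prod>k<n. \<integral>\<^sup>+\<omega>. exp (backward_step c T n k \<omega>) \<partial>M) = ramp_mgf c T n 1"
    using prod_exp_backward_step[OF assms(1,2), of 1 c] by simp
qed (auto simp: ramp_mgf_def)

text \<open>The choice p = sqrt n gives (1 + p)^2 - (1 + p) = n + sqrt n, so the moment of a single
  step stays bounded while exp (- p e) beats the number n^2 of steps. In the last term each of these
  n^2 steps contributes the factor exp (- c^2 T / (2 n)).\<close>

lemma grid_event_lower:
  fixes c T u e :: real and n :: nat
  assumes "T > 0" "n > 0" "c > 0"
  defines "b \<equiv> 2 * c * u / T" and "p \<equiv> sqrt n"
  shows "ramp_mgf c T n 1 \<le> exp (- b) * ramp_mgf c T n 2 + exp (b + e) * prob (grid_event c T n u)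
    + n\<^sup>2 * exp (b - p * e) * exp (2 * c\<^sup>2 * (T / n) * ((1 + p)\<^sup>2 - (1 + p)))
    + exp (b / 2) * (ramp_mgf c T n (1 / 2) * exp (- (c\<^sup>2 * T * n / 2)))"
proof -
  have "(\<Prod>k<n + n\<^sup>2. \<integral>\<^sup>+\<omega>. exp (1 / 2 * backward_step c T n k \<omega>) \<partial>M)
      = (\<Prod>k<n. \<integral>\<^sup>+\<omega>. exp (1 / 2 * backward_step c T n k \<omega>) \<partial>M)
        * (\<Prod>k\<in>{n..<n + n\<^sup>2}. \<integral>\<^sup>+\<omega>. exp (1 / 2 * backward_step c T n k \<omega>) \<partial>M)"
    by (subst prod.union_disjoint[symmetric]) (auto intro!: prod.cong)
  also have "(\<Prod>k\<in>{n..<n + n\<^sup>2}. \<integral>\<^sup>+\<omega>. exp (1 / 2 * backward_step c T n k \<omega>) \<partial>M)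
      = (\<Prod>k\<in>{n..<n + n\<^sup>2}. ennreal (exp (2 * c\<^sup>2 * (T / n) * ((1 / 2)\<^sup>2 - 1 / 2))))"
    by (intro prod.cong refl nn_integral_exp_backward_step_past assms) auto
  also have "\<dots> = ennreal (exp (n\<^sup>2 * (2 * c\<^sup>2 * (T / n) * ((1 / 2)\<^sup>2 - 1 / 2))))"
    by (simp add: ennreal_power flip: exp_of_nat_mult)
  also have "n\<^sup>2 * (2 * c\<^sup>2 * (T / n) * ((1 / 2)\<^sup>2 - 1 / 2)) = - (c\<^sup>2 * T * n / 2)"
    using assms(2) by (simp add: field_simps power2_eq_square)
  finally have half: "(\<Prod>k<n + n\<^sup>2. \<integral>\<^sup>+\<omega>. exp (1 / 2 * backward_step c T n k \<omega>) \<partial>M)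
      = ennreal (ramp_mgf c T n (1 / 2) * exp (- (c\<^sup>2 * T * n / 2)))"
    by (subst (asm) prod_exp_backward_step[OF assms(1,2)]) (simp add: ramp_mgf_def flip: ennreal_mult)
  have "ramp_mgf c T n 1 \<le> exp (- b) * ramp_mgf c T n 2 + exp (b + e) *
      prob {\<omega>\<in>space M. \<exists>k\<in>{n..n + n\<^sup>2}. b < (\<Sum>i<k. backward_step c T n i \<omega>)}
    + real (n + n\<^sup>2 - n) * exp (b - p * e) * exp (2 * c\<^sup>2 * (T / n) * ((1 + p)\<^sup>2 - (1 + p)))
    + exp (b / 2) * (ramp_mgf c T n (1 / 2) * exp (- (c\<^sup>2 * T * n / 2)))"
  proof (rule max_sum_lower_bound)
    show "indep_vars (\<lambda>_. borel) (backward_step c T n) {..<n + n\<^sup>2}"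
      using assms by (intro indep_backward_step)
    show "(\<integral>\<^sup>+\<omega>. exp (backward_step c T n k \<omega>) \<partial>M) = 1" if "n \<le> k" for k
      using nn_integral_exp_backward_step_past[OF assms(1,2) that, of 1 c] by simp
    show "(\<integral>\<^sup>+\<omega>. exp ((1 + p) * backward_step c T n k \<omega>) \<partial>M)
        = exp (2 * c\<^sup>2 * (T / n) * ((1 + p)\<^sup>2 - (1 + p)))" if "n \<le> k" for k
      using nn_integral_exp_backward_step_past[OF assms(1,2) that] by simp
    show "(\<Prod>k<n. \<integral>\<^sup>+\<omega>. exp (backward_step c T n k \<omega>) \<partial>M) = ramp_mgf c T n 1"
      using prod_exp_backward_step[OF assms(1,2), of 1 c] by simp
    show "(\<Prod>k<n. \<integral>\<^sup>+\<omega>. exp (2 * backward_step c T n k \<omega>) \<partial>M) = ramp_mgf c T n 2"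
      using prod_exp_backward_step[OF assms(1,2)] by simp
  qed (use half in \<open>auto simp: p_def ramp_mgf_def\<close>)
  then show ?thesis
    unfolding grid_event_eq[OF assms(1-3)] b_def by simp
qed

end

section \<open>Pathwise reflection\<close>

lemma floor_grid_points:
  fixes x h :: real
  assumes "x \<ge> 0" "h > 0"
  shows "real (nat \<lfloor>x * real n / h\<rfloor>) \<le> x * real n / h"
    and "(\<lambda>n. real (nat \<lfloor>x * real n / h\<rfloor>) * (h / real n)) \<longlonglongrightarrow> x"
proof -
  have le: "real (nat \<lfloor>x * real n / h\<rfloor>) \<le> x * real n / h" for n
    using assms by (simp add: of_nat_nat)
  then show "real (nat \<lfloor>x * real n / h\<rfloor>) \<le> x * real n / h" .
  have bounds: "x - h / real n \<le> real (nat \<lfloor>x * real n / h\<rfloor>) * (h / real n) \<and> real (nat \<lfloor>x * real n / h\<rfloor>) * (h / real n) \<le> x"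
    if "n > 0" for n
  proof -
    have "real (nat \<lfloor>x * real n / h\<rfloor>) \<ge> x * real n / h - 1"
      using assms by linarith
    then have "(x * real n / h - 1) * (h / real n) \<le> real (nat \<lfloor>x * real n / h\<rfloor>) * (h / real n)"
      using assms by (intro mult_right_mono) auto
    moreover have "(x * real n / h - 1) * (h / real n) = x - h / real n"
      using that assms by (simp add: field_simps)
    moreover have "real (nat \<lfloor>x * real n / h\<rfloor>) * (h / real n) \<le> (x * real n / h) * (h / real n)"
      using assms le[of n] by (intro mult_right_mono) auto
    ultimately show ?thesis
      using that assms by simp
  qed
  have "(\<lambda>n. x - h / real n) \<longlonglongrightarrow> x"
    by real_asymp
  moreover have "(\<lambda>n. x) \<longlonglongrightarrow> x"
    by simp
  ultimately show "(\<lambda>n. real (nat \<lfloor>x * real n / h\<rfloor>) * (h / real n)) \<longlonglongrightarrow> x"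
    by (rule tendsto_sandwich[rotated 2])
       (use bounds in \<open>auto intro: eventually_mono[OF eventually_gt_at_top[of 0]]\<close>)
qed

text \<open>By the mean value theorem for an antiderivative, the integral over a cell is h times an
  intermediate value of f. Uniform continuity bounds each cell error by h e', hence the total by T
  e' = e/2.\<close>

lemma riemann_sum_tendsto:
  fixes f :: "real \<Rightarrow> real"
  assumes "continuous_on UNIV f" "T > 0"
  shows "(\<lambda>n. T * ((\<Sum>k<n. f (T - real k * (T / n))) / n)) \<longlonglongrightarrow> (LBINT r:{0..T}. f r)"
proof -
  have cont: "continuous_on {0..T} f"
    using assms(1) continuous_on_subset by blast
  obtain F where F: "\<And>x. x \<in> {0..T} \<Longrightarrow> (F has_vector_derivative f x) (at x within {0..T})"
    using antiderivative_continuous[OF cont] by blast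
  have int: "(LBINT r:{0..T}. f r) = F T - F 0"
  proof -
    have "(LBINT r:{0..T}. f r) = integral {0..T} f"
      using cont by (intro set_borel_integral_eq_integral borel_integrable_atLeastAtMost')
    also have "\<dots> = F T - F 0"
      using fundamental_theorem_of_calculus[of 0 T F f] F assms(2) by (intro integral_unique) auto
    finally show ?thesis .
  qed
  show ?thesis
  proof (rule LIMSEQ_I)
    fix e :: real
    assume "e > 0"
    define e' where "e' = e / (2 * T)"
    have "e' > 0"
      using \<open>e > 0\<close> assms(2) by (simp add: e'_def)
    have "uniformly_continuous_on {0..T} f"
      using cont by (intro compact_uniformly_continuous) auto
    then obtain d where d: "d > 0"
      "\<And>x y. x \<in> {0..T} \<Longrightarrow> y \<in> {0..T} \<Longrightarrow> \<bar>y - x\<bar> < d \<Longrightarrow> \<bar>f y - f x\<bar> < e'"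
      unfolding uniformly_continuous_on_def dist_real_def using \<open>e' > 0\<close> by meson
    obtain n0 :: nat where n0: "T / d < n0"
      using reals_Archimedean2 by blast
    have "norm (T * ((\<Sum>k<n. f (T - real k * (T / n))) / n) - (LBINT r:{0..T}. f r)) < e" if "n \<ge> Suc n0" for n
    proof -
      define h where "h = T / n"
      have "n > 0" using that by simp
      have "real n0 < real n"
        using that by simp
      with n0 have "T / d < n"
        by linarith
      then have h: "h > 0" "h < d" "n * h = T"
        using assms(2) d(1) \<open>n > 0\<close> by (simp_all add: h_def field_simps)
      define G where "G k = F (T - real k * h)" for k
      have cell: "\<bar>G k - G (Suc k) - h * f (T - real k * h)\<bar> \<le> h * e'" if "k < n" for k
      proof -
        let ?a = "T - real (Suc k) * h" and ?b = "T - real k * h"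
        have "real (Suc k) * h \<le> n * h"
          using that h(1) by (intro mult_right_mono) auto
        then have a: "0 \<le> ?a" "?a < ?b" "?b \<le> T" "?b - ?a = h"
          using h by (auto simp: algebra_simps)
        have "\<exists>x\<in>{?a<..<?b}. F ?b - F ?a = (\<lambda>y. y * f x) (?b - ?a)"
        proof (rule mvt_simple[OF a(2)])
          fix x assume x: "?a \<le> x" "x \<le> ?b"
          have "(F has_vector_derivative f x) (at x within {?a..?b})"
          proof (rule has_vector_derivative_within_subset[OF F])
            show "x \<in> {0..T}"
              using x a(1,3) unfolding atLeastAtMost_iff by linarith
            show "{?a..?b} \<subseteq> {0..T}"
              using a(1,3) unfolding atLeastatMost_subset_iff by blast
          qed
          then show "(F has_derivative (\<lambda>y. y * f x)) (at x within {?a..?b})"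
            by (simp add: has_vector_derivative_def)
        qed
        then obtain x where x: "x \<in> {?a<..<?b}" "F ?b - F ?a = h * f x"
          using a(4) by auto
        have "\<bar>f x - f ?b\<bar> < e'"
          using x(1) a h(2)
          by (intro d(2)) (unfold greaterThanLessThan_iff atLeastAtMost_iff, linarith+)
        then have "h * \<bar>f x - f ?b\<bar> \<le> h * e'"
          using h(1) by simp
        then show ?thesis
          using x(2) h(1) by (simp add: G_def abs_mult flip: right_diff_distrib)
      qed
      have "(\<Sum>k<n. G k - G (Suc k)) = G 0 - G n"
        by (rule sum_lessThan_telescope')
      also have "\<dots> = F T - F 0"
        using h(3) by (simp add: G_def)
      finally have tele: "F T - F 0 = (\<Sum>k<n. G k - G (Suc k))" ..
      have "T * ((\<Sum>k<n. f (T - real k * (T / n))) / n) = (\<Sum>k<n. h * f (T - real k * h))"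
        by (simp add: h_def sum_distrib_left sum_divide_distrib)
      then have "\<bar>F T - F 0 - T * ((\<Sum>k<n. f (T - real k * (T / n))) / n)\<bar>
          = \<bar>\<Sum>k<n. G k - G (Suc k) - h * f (T - real k * h)\<bar>"
        by (simp add: tele sum_subtractf)
      also have "\<dots> \<le> (\<Sum>k<n. h * e')"
        by (intro order_trans[OF sum_abs] sum_mono cell) simp
      also have "\<dots> = T * e'"
        using h(3) by simp
      also have "\<dots> < e"
        using assms(2) \<open>e > 0\<close> by (simp add: e'_def)
      finally show ?thesis
        by (simp add: int abs_minus_commute)
    qed
    then show "\<exists>n0. \<forall>n\<ge>n0. norm (T * ((\<Sum>k<n. f (T - real k * (T / n))) / n) - (LBINT r:{0..T}. f r)) < e"
      by blast
  qed
qed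

text \<open>By definition \<open>Sup X\<close> on the reals is the least upper bound; if there is none, then it is a
  fixed value that does not depend on \<open>X\<close>.\<close>
lemma Sup_real_unbounded:
  fixes X :: "real set"
  assumes "\<not> bdd_above X"
  shows "Sup X = Sup UNIV"
proof -
  have "(\<lambda>z. \<forall>x\<in>X. x \<le> z) = (\<lambda>_. False)"
    using assms by (auto simp: bdd_above_def fun_eq_iff)
  moreover have "(\<lambda>z. \<forall>x\<in>(UNIV :: real set). x \<le> z) = (\<lambda>_. False)"
    by (auto simp: fun_eq_iff not_le intro: lt_ex gt_ex)
  ultimately show ?thesis
    unfolding Sup_real_def by metis
qed

text \<open>Replaces an uncountable quantifier by a countable one, for measurability. Writing the
  points as t - |r| lets r range over all rationals.\<close>

lemma ball_atMost_iff_rat: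
  fixes f :: "real \<Rightarrow> real"
  assumes "continuous_on UNIV f"
  shows "(\<forall>s\<le>t. a \<le> f s) \<longleftrightarrow> (\<forall>r::rat. a \<le> f (t - \<bar>of_rat r\<bar>))"
proof safe
  fix s assume rat: "\<forall>r::rat. a \<le> f (t - \<bar>of_rat r\<bar>)" and "s \<le> t"
  have "continuous_on (closure \<rat>) (\<lambda>r. f (t - \<bar>r\<bar>))"
    by (intro continuous_on_compose2[OF assms] continuous_intros) auto
  then have "a \<le> f (t - \<bar>t - s\<bar>)"
    by (rule continuous_ge_on_closure) (use rat in \<open>auto simp: Rats_closure_real elim: Rats_cases\<close>)
  then show "a \<le> f s"
    using \<open>s \<le> t\<close> by simp
qed auto

section \<open>The reflection map on a deterministic continuous path\<close>

locale reflected_path =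
  fixes f q :: "real \<Rightarrow> real"
  assumes cont: "continuous_on UNIV f"
    and q_def: "\<And>t. q t = (SUP s\<in>{..t}. f t - f s)"
begin

lemma bdd_atMost:
  assumes "bdd_below (f ` {..0})"
  shows "bdd_above ((\<lambda>s. f t - f s) ` {..t})"
proof -
  have "compact (f ` {0..t})"
    using cont by (intro compact_continuous_image) (auto intro: continuous_on_subset)
  then have "bdd_below (f ` {..0} \<union> f ` {0..t})"
    using assms by (simp add: bounded_imp_bdd_below compact_imp_bounded)
  then have "bdd_below (f ` {..t})"
    by (rule bdd_below_mono) force
  then obtain m where "\<And>s. s \<le> t \<Longrightarrow> m \<le> f s"
    by (auto simp: bdd_below_def)
  then show ?thesis
    by (auto simp: bdd_above_def intro!: exI[of _ "f t - m"])
qed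

text \<open>The pasts of 0 and of t differ by a compact interval, so if one is unbounded then both
  are. The default value of the supremum is then the same for all t, and q is a constant path, in
  particular continuous.\<close>

lemma q_unbounded:
  assumes "\<not> bdd_below (f ` {..0})"
  shows "q t = Sup UNIV"
  unfolding q_def
proof (rule Sup_real_unbounded, rule notI)
  assume "bdd_above ((\<lambda>s. f t - f s) ` {..t})"
  then obtain m where m: "\<And>s. s \<le> t \<Longrightarrow> f t - f s \<le> m"
    by (auto simp: bdd_above_def)
  have "compact (f ` {t..0})"
    using cont by (intro compact_continuous_image) (auto intro: continuous_on_subset)
  moreover have "bdd_below (f ` {..t})"
    using m by (auto simp: bdd_below_def intro!: exI[of _ "f t - m"] simp: field_simps)
  ultimately have "bdd_below (f ` {..t} \<union> f ` {t..0})"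
    by (simp add: bounded_imp_bdd_below compact_imp_bounded)
  then have "bdd_below (f ` {..0})"
    by (rule bdd_below_mono) force
  with assms show False ..
qed

lemma q_le_iff:
  assumes "bdd_below (f ` {..0})"
  shows "q t \<le> a \<longleftrightarrow> (\<forall>s\<le>t. f t - f s \<le> a)"
  unfolding q_def using cSUP_le_iff[OF _ bdd_atMost[OF assms]] by auto

lemma diff_le_q:
  assumes "bdd_below (f ` {..0})" "s \<le> t"
  shows "f t - f s \<le> q t"
  using q_le_iff[OF assms(1), of t "q t"] assms(2) by auto

lemma q_nonneg:
  assumes "bdd_below (f ` {..0})"
  shows "0 \<le> q t"
  using diff_le_q[OF assms, of t t] by simp

text \<open>For a bounded past, f - q is the running infimum of f, and its change over an interval
  is at most the oscillation of f there.\<close>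

lemma cont_q: "continuous_on UNIV q"
proof (cases "bdd_below (f ` {..0})")
  case False
  then show ?thesis
    using q_unbounded by (simp cong: continuous_on_cong)
next
  case bdd: True
  have close: "\<bar>(f t - q t) - (f t' - q t')\<bar> \<le> e"
    if "t \<le> t'" and "\<And>x y. x \<in> {t..t'} \<Longrightarrow> y \<in> {t..t'} \<Longrightarrow> f x - f y \<le> e" for t t' e
  proof -
    have "q t \<le> q t' + f t - f t'"
      unfolding q_le_iff[OF bdd]
    proof safe
      fix s assume "s \<le> t"
      then show "f t - f s \<le> q t' + f t - f t'"
        using diff_le_q[OF bdd, of s t'] \<open>t \<le> t'\<close> by simp
    qed
    moreover have "q t' \<le> f t' - f t + q t + e"
      unfolding q_le_iff[OF bdd]
    proof safe
      fix s assume "s \<le> t'"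
      show "f t' - f s \<le> f t' - f t + q t + e"
      proof (cases "s \<le> t")
        case True
        then show ?thesis
          using diff_le_q[OF bdd True] that(2)[of t t] \<open>t \<le> t'\<close> by simp
      next
        case False
        then show ?thesis
          using q_nonneg[OF bdd, of t] that(2)[of t s] \<open>s \<le> t'\<close> by simp
      qed
    qed
    moreover have "0 \<le> e"
      using that(2)[of t t] that(1) by simp
    ultimately show ?thesis
      by linarith
  qed
  have "isCont (\<lambda>t. f t - q t) x" for x
    unfolding isCont_def
  proof (rule LIM_I)
    fix e :: real assume "e > 0"
    have "isCont f x"
      using cont by (simp add: continuous_on_eq_continuous_at)
    then obtain d where d: "d > 0" "\<And>y. \<bar>y - x\<bar> < d \<Longrightarrow> \<bar>f y - f x\<bar> < e / 4"
      using \<open>e > 0\<close> unfolding continuous_at_eps_delta dist_real_def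
      by (metis divide_pos_pos zero_less_numeral)
    have "norm ((f y - q y) - (f x - q x)) < e" if "\<bar>y - x\<bar> < d" for y
    proof -
      have osc: "f v - f w \<le> e / 2" if "v \<in> {min x y..max x y}" "w \<in> {min x y..max x y}" for v w
      proof -
        have "\<bar>v - x\<bar> < d" "\<bar>w - x\<bar> < d"
          using that \<open>\<bar>y - x\<bar> < d\<close> by (auto simp: min_def max_def split: if_splits)
        from this[THEN d(2)] show ?thesis
          by linarith
      qed
      have "\<bar>(f (min x y) - q (min x y)) - (f (max x y) - q (max x y))\<bar> \<le> e / 2"
        by (rule close) (use osc in auto)
      then show ?thesis
        using \<open>e > 0\<close> by (cases "x \<le> y"; auto simp: min_def max_def; linarith)
    qed
    then show "\<exists>d>0. \<forall>y. y \<noteq> x \<and> norm (y - x) < d \<longrightarrow> norm ((f y - q y) - (f x - q x)) < e"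
      using d(1) by auto
  qed
  then have "continuous_on UNIV (\<lambda>t. f t - q t)"
    by (simp add: continuous_on_eq_continuous_at)
  then have "continuous_on UNIV (\<lambda>t. f t - (f t - q t))"
    by (rule continuous_on_diff[OF cont])
  then show ?thesis by simp
qed

lemma set_integrable_f [simp]: "set_integrable lborel {a..b} f"
  using cont by (intro borel_integrable_atLeastAtMost') (auto intro: continuous_on_subset)

lemma set_integrable_q [simp]: "set_integrable lborel {a..b} q"
  using cont_q by (intro borel_integrable_atLeastAtMost') (auto intro: continuous_on_subset)

lemma set_integrable_const [simp]: "set_integrable lborel {a..b::real} (\<lambda>_. x :: real)"
  by (intro borel_integrable_atLeastAtMost') auto

lemma set_integral_const_interval: "(a :: real) \<le> b \<Longrightarrow> (LBINT r:{a..b}. (x :: real)) = (b - a) * x"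
  by (simp add: set_integral_const)

lemma integral_q_ge:
  assumes "bdd_below (f ` {..0})" "T > 0" "s \<le> 0"
  shows "(LBINT r:{0..T}. f r) - T * f s \<le> (LBINT r:{0..T}. q r)"
proof -
  have "(LBINT r:{0..T}. f r) - T * f s = (LBINT r:{0..T}. f r - f s)"
    using assms(2) by (simp add: set_integral_diff set_integral_const_interval)
  also have "\<dots> \<le> (LBINT r:{0..T}. q r)"
    using diff_le_q[OF assms(1)] assms(3)
    by (intro set_integral_mono set_integral_diff) auto
  finally show ?thesis .
qed

lemma integral_q_gt_cases:
  assumes "T > 0" "u < (LBINT r:{0..T}. q r)"
  obtains s where "s \<le> 0" "u < (LBINT r:{0..T}. f r) - T * f s"
  | x y where "x \<in> {0..T}" "y \<in> {0..T}" "u < T * (f x - f y)"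
proof (cases "bdd_below (f ` {..0})")
  case False
  \<comment> \<open>With an unbounded past f s falls below every level, so the first alternative
    holds whatever the default value of q is.\<close>
  then obtain s where "s \<le> 0" "f s < ((LBINT r:{0..T}. f r) - u) / T"
    unfolding bdd_below_def by (force simp: not_le)
  then show ?thesis
    using that(1) assms(1) by (simp add: field_simps)
next
  case bdd: True
  show ?thesis
  \<comment> \<open>\<open>f 0 - q 0\<close> is the infimum of f over the past of 0. If f stays
    above it on [0, T], it remains the infimum over the past of each t there.\<close>
  proof (cases "\<forall>y\<in>{0..T}. f 0 - q 0 \<le> f y")
    case True
    have "q t \<le> f t - (f 0 - q 0)" if "t \<in> {0..T}" for t
      unfolding q_le_iff[OF bdd]
    proof safe
      fix s assume "s \<le> t"
      have "f 0 - q 0 \<le> f s"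
      proof (cases "s \<le> 0")
        case True
        then show ?thesis
          using diff_le_q[OF bdd True] by simp
      next
        case False
        then show ?thesis
          using True \<open>s \<le> t\<close> that by auto
      qed
      then show "f t - f s \<le> f t - (f 0 - q 0)"
        by simp
    qed
    then have "(LBINT r:{0..T}. q r) \<le> (LBINT r:{0..T}. f r - (f 0 - q 0))"
      by (intro set_integral_mono set_integral_diff) auto
    also have "\<dots> = (LBINT r:{0..T}. f r) - T * (f 0 - q 0)"
      using assms(1)
      by (subst set_integral_diff) (simp_all add: set_integral_const_interval algebra_simps)
    finally have "T * q 0 > u - (LBINT r:{0..T}. f r) + T * f 0"
      using assms(2) by (simp add: right_diff_distrib)
    then have "\<not> q 0 \<le> (u - (LBINT r:{0..T}. f r) + T * f 0) / T"
      using assms(1) by (simp add: field_simps)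
    then obtain s where "s \<le> 0" "(u - (LBINT r:{0..T}. f r) + T * f 0) / T < f 0 - f s"
      unfolding q_le_iff[OF bdd] by (auto simp: not_le)
    then show ?thesis
      using that(1) assms(1) by (simp add: field_simps)
  next
    case False
    have cont_T: "continuous_on {0..T} f"
      using cont continuous_on_subset by blast
    obtain y where y: "y \<in> {0..T}" "\<And>t. t \<in> {0..T} \<Longrightarrow> f y \<le> f t"
      using continuous_attains_inf[OF _ _ cont_T] assms(1) by auto
    obtain x where x: "x \<in> {0..T}" "\<And>t. t \<in> {0..T} \<Longrightarrow> f t \<le> f x"
      using continuous_attains_sup[OF _ _ cont_T] assms(1) by auto
    \<comment> \<open>The minimum over [0, T] now lies below the entire past of 0, so f y bounds f
      from below up to time T and q is at most the oscillation on [0, T].\<close>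
    have below: "f y < f 0 - q 0"
      using False y(2) by fastforce
    have "q t \<le> f x - f y" if t: "t \<in> {0..T}" for t
      unfolding q_le_iff[OF bdd]
    proof safe
      fix s assume "s \<le> t"
      have "f y \<le> f s"
      proof (cases "s \<le> 0")
        case True
        then show ?thesis
          using diff_le_q[OF bdd True] below by simp
      next
        case False
        then show ?thesis
          using y(2) \<open>s \<le> t\<close> t by auto
      qed
      then show "f t - f s \<le> f x - f y"
        using x(2)[OF t] by simp
    qed
    then have "(LBINT r:{0..T}. q r) \<le> (LBINT r:{0..T}. f x - f y)"
      by (intro set_integral_mono) auto
    also have "\<dots> = T * (f x - f y)"
      using assms(1) by (simp add: set_integral_const_interval right_diff_distrib)
    finally show ?thesis
      using that(2)[OF x(1) y(1)] assms(2) by simp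
  qed
qed

end

section \<open>Passage to the limit\<close>

text \<open>1/3 and 1/2 are the integrals of x^2 and x over [0, 1], the limits of the averaged
  squared and linear weights. At q = 1 the exponent is 2 (1/3 - 1/2) c^2 T = - c^2 T / 3, the
  correction term of the theorem.\<close>

lemma tendsto_ramp_mgf [tendsto_intros]:
  "(\<lambda>n. ramp_mgf c T n q) \<longlonglongrightarrow> exp (2 * c\<^sup>2 * T * (q\<^sup>2 / 3 - q / 2))"
proof -
  have "(\<lambda>n. (real n + 1) * (2 * real n + 1) / (6 * (real n)\<^sup>2)) \<longlonglongrightarrow> 1 / 3"
    "(\<lambda>n. (real n + 1) / (2 * real n)) \<longlonglongrightarrow> 1 / 2"
    by real_asymp+
  then have "(\<lambda>n. ramp_mgf c T n q) \<longlonglongrightarrow> exp (2 * c\<^sup>2 * T * (q\<^sup>2 * (1 / 3) - q * (1 / 2)))"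
    unfolding ramp_mgf_def
    by (intro tendsto_exp tendsto_mult[OF tendsto_const] tendsto_diff)
  then show ?thesis by simp
qed

text \<open>Fatou's lemma for events. The grids for successive n are not nested, so monotone
  continuity is applied to the tail intersections \<open>H N\<close>, which increase to A.\<close>

lemma (in prob_space) prob_le_lim:
  assumes "A \<in> events" "\<And>n. G n \<in> events"
    and "\<And>\<omega>. \<omega> \<in> A \<Longrightarrow> eventually (\<lambda>n. \<omega> \<in> G n) sequentially"
    and "eventually (\<lambda>n. prob (G n) \<le> r n) sequentially" "r \<longlonglongrightarrow> l"
  shows "prob A \<le> l"
proof -
  define H where "H N = (\<Inter>n\<in>{N..}. A \<inter> G n)" for N
  have "H N \<in> events" for N
    unfolding H_def using assms(1,2) by (intro sets.countable_INT') auto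
  moreover have "incseq H"
    by (force simp: incseq_def H_def)
  ultimately have "(\<lambda>N. prob (H N)) \<longlonglongrightarrow> prob (\<Union>N. H N)"
    by (intro finite_Lim_measure_incseq) auto
  also have "(\<Union>N. H N) = A"
  proof
    show "A \<subseteq> (\<Union>N. H N)"
    proof
      fix \<omega> assume "\<omega> \<in> A"
      with assms(3) obtain N where "\<forall>n\<ge>N. \<omega> \<in> G n"
        by (auto simp: eventually_sequentially)
      with \<open>\<omega> \<in> A\<close> have "\<omega> \<in> H N"
        by (auto simp: H_def)
      then show "\<omega> \<in> (\<Union>N. H N)"
        by blast
    qed
  qed (auto simp: H_def)
  finally have "(\<lambda>N. prob (H N)) \<longlonglongrightarrow> prob A" .
  moreover have "eventually (\<lambda>n. prob (H n) \<le> r n) sequentially"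
    using assms(4)
  proof eventually_elim
    case (elim n)
    have "prob (H n) \<le> prob (G n)"
      by (intro finite_measure_mono assms) (auto simp: H_def)
    with elim show ?case by simp
  qed
  ultimately show ?thesis
    using assms(5) by (intro tendsto_le[OF sequentially_bot])
qed

section \<open>Measurability of the workload and of its integral\<close>

context two_sided_brownian_motion
begin

lemma measurable_B [measurable]: "B t \<in> borel_measurable M"
  by (rule random_variable_B)

lemma measurable_drifted [measurable]: "(\<lambda>\<omega>. drifted B c \<omega> t) \<in> borel_measurable M"
  unfolding drifted_def by measurable

lemma continuous_drifted: "\<omega> \<in> space M \<Longrightarrow> continuous_on UNIV (drifted B c \<omega>)"
  unfolding drifted_def[abs_def] by (intro continuous_intros continuous_paths)

lemma reflected_path_workload:
  assumes "\<omega> \<in> space M"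
  shows "reflected_path (drifted B c \<omega>) (\<lambda>t. workload B c t \<omega>)"
proof
  show "continuous_on UNIV (drifted B c \<omega>)"
    using assms by (rule continuous_drifted)
  show "workload B c t \<omega> = (SUP s\<in>{..t}. drifted B c \<omega> t - drifted B c \<omega> s)" for t
    unfolding workload_def drifted_def by (simp add: algebra_simps)
qed

definition bounded_paths :: "real \<Rightarrow> 'a set" where
  "bounded_paths c = {\<omega>\<in>space M. bdd_below (drifted B c \<omega> ` {..0})}"

lemma sets_bounded_paths [measurable]: "bounded_paths c \<in> sets M"
proof -
  have "bdd_below (drifted B c \<omega> ` {..0}) \<longleftrightarrow>
      (\<exists>N::nat. \<forall>r::rat. - real N \<le> drifted B c \<omega> (0 - \<bar>of_rat r\<bar>))" if "\<omega> \<in> space M" for \<omega>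
    unfolding ball_atMost_iff_rat[OF continuous_drifted[OF that], symmetric]
  proof
    assume "bdd_below (drifted B c \<omega> ` {..0})"
    then obtain m where m: "\<And>s. s \<le> 0 \<Longrightarrow> m \<le> drifted B c \<omega> s"
      by (auto simp: bdd_below_def)
    obtain N :: nat where "- m \<le> N"
      using real_arch_simple by blast
    with m show "\<exists>N::nat. \<forall>s\<le>0. - real N \<le> drifted B c \<omega> s"
      by (intro exI[of _ N]) force
  qed (auto simp: bdd_below_def)
  then have "bounded_paths c =
     {\<omega>\<in>space M. \<exists>N::nat. \<forall>r::rat. - real N \<le> drifted B c \<omega> (0 - \<bar>of_rat r\<bar>)}"
    unfolding bounded_paths_def by (intro Collect_cong conj_cong refl)
  also have "\<dots> \<in> sets M"
    by measurable
  finally show ?thesis .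
qed

lemma measurable_workload [measurable]: "workload B c t \<in> borel_measurable M"
proof (rule borel_measurableI_le)
  fix a :: real
  have "workload B c t \<omega> \<le> a \<longleftrightarrow>
     (if \<omega> \<in> bounded_paths c
      then \<forall>r::rat. drifted B c \<omega> t - a \<le> drifted B c \<omega> (t - \<bar>of_rat r\<bar>)
      else Sup UNIV \<le> a)" if "\<omega> \<in> space M" for \<omega>
  proof -
    interpret reflected_path "drifted B c \<omega>" "\<lambda>t. workload B c t \<omega>"
      using that by (rule reflected_path_workload)
    show ?thesis
      unfolding ball_atMost_iff_rat[OF cont, symmetric]
      using q_le_iff[of t a] q_unbounded[of t] that
      by (auto simp: bounded_paths_def algebra_simps)
  qed
  then have "{\<omega>\<in>space M. workload B c t \<omega> \<le> a} =
    {\<omega>\<in>space M. if \<omega> \<in> bounded_paths c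
      then \<forall>r::rat. drifted B c \<omega> t - a \<le> drifted B c \<omega> (t - \<bar>of_rat r\<bar>)
      else Sup UNIV \<le> a}"
    by (intro Collect_cong conj_cong refl)
  also have "\<dots> \<in> sets M"
    by measurable
  finally show "{\<omega>\<in>space M. workload B c t \<omega> \<le> a} \<in> sets M" .
qed

text \<open>Continuity of the paths of the workload makes the integral a pointwise limit of finite
  sums of random variables.\<close>

lemma measurable_integral_workload [measurable]:
  assumes "T > 0"
  shows "(\<lambda>\<omega>. LBINT r:{0..T}. workload B c r \<omega>) \<in> borel_measurable M"
proof (rule borel_measurable_LIMSEQ_real)
  fix \<omega> assume "\<omega> \<in> space M"
  then interpret reflected_path "drifted B c \<omega>" "\<lambda>t. workload B c t \<omega>"
    by (rule reflected_path_workload)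
  show "(\<lambda>n. T * ((\<Sum>k<n. workload B c (T - real k * (T / n)) \<omega>) / n))
      \<longlonglongrightarrow> (LBINT r:{0..T}. workload B c r \<omega>)"
    using cont_q assms by (rule riemann_sum_tendsto)
qed measurable

section \<open>Explicit bounds for fixed u and T\<close>

lemma eventually_grid_event:
  assumes "\<omega> \<in> space M" "T > 0" "s \<le> 0"
    and "u < (LBINT r:{0..T}. drifted B c \<omega> r) - T * drifted B c \<omega> s"
  shows "eventually (\<lambda>n. \<omega> \<in> grid_event c T n u) sequentially"
proof -
  let ?f = "drifted B c \<omega>"
  define j where "j n = nat \<lfloor>(- s) * real n / T\<rfloor>" for n :: nat
  have cont: "continuous_on UNIV ?f"
    using assms(1) by (rule continuous_drifted)
  have "(\<lambda>n. - (real (j n) * (T / n))) \<longlonglongrightarrow> - (- s)"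
    unfolding j_def by (intro tendsto_minus floor_grid_points) (use assms in auto)
  moreover have "isCont ?f s"
    using cont by (simp add: continuous_on_eq_continuous_at)
  ultimately have "(\<lambda>n. ?f (- (real (j n) * (T / n)))) \<longlonglongrightarrow> ?f s"
    by (intro isCont_tendsto_compose[of s ?f]) simp_all
  then have "(\<lambda>n. T * ((\<Sum>k<n. ?f (T - real k * (T / n))) / n) - T * ?f (- (real (j n) * (T / n))))
      \<longlonglongrightarrow> (LBINT r:{0..T}. ?f r) - T * ?f s"
    by (intro tendsto_intros riemann_sum_tendsto cont assms)
  \<comment> \<open>The second condition, n \<ge> -s/T, ensures that s lies within the horizon nT;
    this yields j n \<le> n^2.\<close>
  from order_tendstoD(1)[OF this assms(4)]
    eventually_ge_at_top[of "nat \<lceil>- s / T\<rceil>"]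
  show ?thesis
  proof eventually_elim
    case (elim n)
    have "real (j n) \<le> (- s) * real n / T"
      unfolding j_def by (intro floor_grid_points) (use assms in auto)
    also have "\<dots> = (- s / T) * real n"
      by simp
    also have "\<dots> \<le> real n * real n"
      using elim(2) by (intro mult_right_mono) (auto simp: nat_le_iff ceiling_le_iff)
    finally have "real (j n) \<le> real (n\<^sup>2)"
      by (simp add: power2_eq_square)
    then have "j n \<le> n\<^sup>2"
      by (simp only: of_nat_le_iff)
    with elim(1) assms(1) show ?case
      unfolding grid_event_def by (auto simp: right_diff_distrib intro!: exI[of _ "j n"])
  qed
qed

definition range_event :: "real \<Rightarrow> real \<Rightarrow> nat \<Rightarrow> real \<Rightarrow> 'a set" where
  "range_event \<sigma> T n r = {\<omega>\<in>space M. \<exists>k\<le>n. r < \<sigma> * (B (real k * (T / n)) \<omega> - B 0 \<omega>)}"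

lemma sets_range_event [measurable]: "range_event \<sigma> T n r \<in> sets M"
  unfolding range_event_def by measurable

lemma eventually_range_event:
  assumes "\<omega> \<in> space M" "T > 0" "x \<in> {0..T}" "r < \<sigma> * (B x \<omega> - B 0 \<omega>)"
  shows "eventually (\<lambda>n. \<omega> \<in> range_event \<sigma> T n r) sequentially"
proof -
  define k where "k n = nat \<lfloor>x * real n / T\<rfloor>" for n :: nat
  have "(\<lambda>n. real (k n) * (T / n)) \<longlonglongrightarrow> x"
    unfolding k_def by (intro floor_grid_points) (use assms in auto)
  moreover have "isCont (\<lambda>t. B t \<omega>) x"
    using continuous_paths[OF assms(1)] by (simp add: continuous_on_eq_continuous_at)
  ultimately have "(\<lambda>n. B (real (k n) * (T / n)) \<omega>) \<longlonglongrightarrow> B x \<omega>"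
    by (rule isCont_tendsto_compose[rotated])
  then have "(\<lambda>n. \<sigma> * (B (real (k n) * (T / n)) \<omega> - B 0 \<omega>)) \<longlonglongrightarrow> \<sigma> * (B x \<omega> - B 0 \<omega>)"
    by (intro tendsto_intros)
  from order_tendstoD(1)[OF this assms(4)]
  show ?thesis
  proof eventually_elim
    case (elim n)
    have "real (k n) \<le> x * real n / T"
      unfolding k_def by (intro floor_grid_points) (use assms in auto)
    also have "\<dots> \<le> real n"
      using assms by (simp add: field_simps mult_right_mono)
    finally have "k n \<le> n"
      by simp
    with elim assms(1) show ?case
      unfolding range_event_def by blast
  qed
qed

lemma workload_integral_upper_bound:
  assumes "c > 0" "T > 0" and r: "r = (u / T - c * T) / 2" "r > 0"
  shows "prob {\<omega>\<in>space M. u < (LBINT r:{0..T}. workload B c r \<omega>)}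
    \<le> exp (- (2 * c * u / T)) * exp (- (c\<^sup>2 * T / 3)) + 2 * exp (- (r\<^sup>2 / (2 * T)))"
proof (rule prob_le_lim)
  let ?G = "\<lambda>n. grid_event c T n u \<union> (range_event 1 T n r \<union> range_event (- 1) T n r)"
  show "{\<omega>\<in>space M. u < (LBINT r:{0..T}. workload B c r \<omega>)} \<in> events"
    using measurable_integral_workload[OF assms(2)] by measurable
  show "?G n \<in> events" for n
    by measurable
  show "eventually (\<lambda>n. \<omega> \<in> ?G n) sequentially"
    if "\<omega> \<in> {\<omega>\<in>space M. u < (LBINT r:{0..T}. workload B c r \<omega>)}" for \<omega>
  proof -
    from that have \<omega>: "\<omega> \<in> space M" "u < (LBINT r:{0..T}. workload B c r \<omega>)"
      by auto
    interpret reflected_path "drifted B c \<omega>" "\<lambda>t. workload B c t \<omega>"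
      using \<omega>(1) by (rule reflected_path_workload)
    from assms(2) \<omega>(2) show ?thesis
    proof (cases rule: integral_q_gt_cases)
      case (1 s)
      from eventually_grid_event[OF \<omega>(1) assms(2) this] show ?thesis
        by (rule eventually_mono) auto
    next
      case (2 x y)
      \<comment> \<open>The drift contributes at most c T to the oscillation, so B x - B y > u/T - c
        T = 2 r, and one of the two values differs from B 0 by more than r.\<close>
      have "c * (x - y) \<ge> c * (- T)"
        using 2 assms(1) by (intro mult_left_mono) auto
      then have "drifted B c \<omega> x - drifted B c \<omega> y \<le> B x \<omega> - B y \<omega> + c * T"
        by (simp add: drifted_def algebra_simps)
      moreover have "u / T < drifted B c \<omega> x - drifted B c \<omega> y"
        using 2(3) assms(2) by (simp add: field_simps)
      ultimately have "2 * r < B x \<omega> - B y \<omega>"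
        using r by simp
      then have "r < 1 * (B x \<omega> - B 0 \<omega>) \<or> r < (- 1) * (B y \<omega> - B 0 \<omega>)"
        by (cases "r < B x \<omega> - B 0 \<omega>") simp_all
      then have "eventually (\<lambda>n. \<omega> \<in> range_event 1 T n r) sequentially \<or>
          eventually (\<lambda>n. \<omega> \<in> range_event (- 1) T n r) sequentially"
        using eventually_range_event[OF \<omega>(1) assms(2)] 2(1,2) by blast
      then show ?thesis
        by (auto elim: eventually_mono)
    qed
  qed
  show "eventually (\<lambda>n. prob (?G n) \<le> exp (- (2 * c * u / T)) * ramp_mgf c T n 1
      + 2 * exp (- (r\<^sup>2 / (2 * T)))) sequentially"
    using eventually_gt_at_top[of 0]
  proof eventually_elim
    case (elim n)
    have "prob (range_event \<sigma> T n r) \<le> exp (- (r\<^sup>2 / (2 * T)))" if "\<bar>\<sigma>\<bar> = 1" for \<sigma>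
      unfolding range_event_def using r(2) assms(2) elim that by (rule grid_range_bound)
    from this[of 1] this[of "- 1"] show ?case
      using grid_event_upper[OF assms(2) elim assms(1), of u]
        measure_Un_le[of "grid_event c T n u" M "range_event 1 T n r \<union> range_event (- 1) T n r"]
        measure_Un_le[of "range_event 1 T n r" M "range_event (- 1) T n r"]
      by simp
  qed
  have "(\<lambda>n. exp (- (2 * c * u / T)) * ramp_mgf c T n 1 + 2 * exp (- (r\<^sup>2 / (2 * T))))
      \<longlonglongrightarrow> exp (- (2 * c * u / T)) * exp (2 * c\<^sup>2 * T * (1\<^sup>2 / 3 - 1 / 2)) + 2 * exp (- (r\<^sup>2 / (2 * T)))"
    by (intro tendsto_intros)
  then show "(\<lambda>n. exp (- (2 * c * u / T)) * ramp_mgf c T n 1 + 2 * exp (- (r\<^sup>2 / (2 * T))))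
      \<longlonglongrightarrow> exp (- (2 * c * u / T)) * exp (- (c\<^sup>2 * T / 3)) + 2 * exp (- (r\<^sup>2 / (2 * T)))"
    by (simp add: mult.commute[of T "c\<^sup>2"])
qed

text \<open>A path with unbounded past eventually lies in the grid events of every level u, so the
  crossing bound, taken with T = 1, applies for all u and tends to 0.\<close>

lemma prob_unbounded_paths:
  assumes "c > 0"
  shows "prob (space M - bounded_paths c) = 0"
proof -
  have bound: "prob (space M - bounded_paths c) \<le> exp (- (2 * c * u / 1)) * exp (2 * c\<^sup>2 * 1 * (1\<^sup>2 / 3 - 1 / 2))" for u
  proof (rule prob_le_lim)
    show "eventually (\<lambda>n. \<omega> \<in> grid_event c 1 n u) sequentially" if "\<omega> \<in> space M - bounded_paths c" for \<omega>
    proof -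
      have \<omega>: "\<omega> \<in> space M" "\<not> bdd_below (drifted B c \<omega> ` {..0})"
        using that by (auto simp: bounded_paths_def)
      then obtain s where s: "s \<le> 0" "drifted B c \<omega> s < (LBINT r:{0..1}. drifted B c \<omega> r) - u"
        unfolding bdd_below_def by (force simp: not_le)
      show ?thesis
        by (rule eventually_grid_event[OF \<omega>(1) _ s(1)]) (use s(2) in auto)
    qed
    show "eventually (\<lambda>n. prob (grid_event c 1 n u) \<le> exp (- (2 * c * u / 1)) * ramp_mgf c 1 n 1) sequentially"
      using eventually_gt_at_top[of 0]
      by eventually_elim (intro grid_event_upper assms zero_less_one)
    show "(\<lambda>n. exp (- (2 * c * u / 1)) * ramp_mgf c 1 n 1)
        \<longlonglongrightarrow> exp (- (2 * c * u / 1)) * exp (2 * c\<^sup>2 * 1 * (1\<^sup>2 / 3 - 1 / 2))"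
      by (intro tendsto_intros)
  qed measurable
  have "(\<lambda>n. exp (- (2 * c * real n / 1)) * exp (2 * c\<^sup>2 * 1 * (1\<^sup>2 / 3 - 1 / 2))) \<longlonglongrightarrow> 0"
    using assms by real_asymp
  then have "prob (space M - bounded_paths c) \<le> 0"
    by (rule LIMSEQ_le_const) (use bound in blast)
  then show ?thesis
    by (simp add: measure_le_0_iff)
qed

text \<open>The slack e serves twice: it raises the level to absorb the error of the Riemann sums,
  and it is the overshoot allowed at the crossing.\<close>

lemma workload_integral_lower_bound_eps:
  assumes "c > 0" "T > 0" "e > 0" and b: "b = 2 * c * u / T + e"
  shows "exp (- (b + e)) * (exp (- (c\<^sup>2 * T / 3)) - exp (- b) * exp (2 * c\<^sup>2 * T / 3))
    \<le> prob {\<omega>\<in>space M. u < (LBINT r:{0..T}. workload B c r \<omega>)}"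
proof -
  let ?E = "{\<omega>\<in>space M. u < (LBINT r:{0..T}. workload B c r \<omega>)}"
  let ?l = "exp (- (b + e)) * (exp (- (c\<^sup>2 * T / 3)) - exp (- b) * exp (2 * c\<^sup>2 * T / 3))"
  have E [measurable]: "?E \<in> events"
    using measurable_integral_workload[OF assms(2)] by measurable
  define v where "v = u + T * e / (2 * c)"
  have v: "v > u" "2 * c * v / T = b"
    using assms(1-3) unfolding b by (simp_all add: v_def field_simps)
  define R where "R n = ramp_mgf c T n 1 - exp (- b) * ramp_mgf c T n 2
    - (real n)\<^sup>2 * exp (b - sqrt n * e) * exp (2 * c\<^sup>2 * (T / n) * ((1 + sqrt n)\<^sup>2 - (1 + sqrt n)))
    - exp (b / 2) * (ramp_mgf c T n (1 / 2) * exp (- (c\<^sup>2 * T * n / 2)))" for n :: nat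
  \<comment> \<open>\<open>prob_le_lim\<close> yields upper bounds only, so it is applied to the
    complement: if the integral is at most u, then the path eventually avoids the grid event of the
    higher level v. The Riemann error does not depend on j, so one n serves all past grid
    points.\<close>
  have "prob (bounded_paths c - ?E) \<le> 1 - ?l"
  proof (rule prob_le_lim)
    show "bounded_paths c - ?E \<in> events" "space M - grid_event c T n v \<in> events" for n
      by measurable
    show "eventually (\<lambda>n. \<omega> \<in> space M - grid_event c T n v) sequentially"
      if "\<omega> \<in> bounded_paths c - ?E" for \<omega>
    proof -
      have \<omega>: "\<omega> \<in> space M" "bdd_below (drifted B c \<omega> ` {..0})"
        "(LBINT r:{0..T}. workload B c r \<omega>) \<le> u"
        using that by (auto simp: bounded_paths_def)
      interpret reflected_path "drifted B c \<omega>" "\<lambda>t. workload B c t \<omega>"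
        using \<omega>(1) by (rule reflected_path_workload)
      let ?I = "LBINT r:{0..T}. drifted B c \<omega> r"
      have "(\<lambda>n. T * ((\<Sum>k<n. drifted B c \<omega> (T - real k * (T / n))) / n)) \<longlonglongrightarrow> ?I"
        using cont assms(2) by (rule riemann_sum_tendsto)
      then have "eventually (\<lambda>n. T * ((\<Sum>k<n. drifted B c \<omega> (T - real k * (T / n))) / n)
          < ?I + (v - u)) sequentially"
        by (rule order_tendstoD(2)) (use v(1) in simp)
      then show ?thesis
      proof eventually_elim
        case (elim n)
        have "\<not> v < T * ((\<Sum>k<n. drifted B c \<omega> (T - real k * (T / n))) / n - drifted B c \<omega> (- (real j * (T / n))))" for j
        proof -
          have "?I - T * drifted B c \<omega> (- (real j * (T / n))) \<le> u"
            using integral_q_ge[OF \<omega>(2) assms(2), of "- (real j * (T / n))"] \<omega>(3) assms(2) by simp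
          with elim show ?thesis
            by (simp add: right_diff_distrib)
        qed
        with \<omega>(1) show ?case
          by (auto simp: grid_event_def)
      qed
    qed
    show "eventually (\<lambda>n. prob (space M - grid_event c T n v) \<le> 1 - exp (- (b + e)) * R n) sequentially"
      using eventually_gt_at_top[of 0]
    proof eventually_elim
      case (elim n)
      have "R n \<le> exp (b + e) * prob (grid_event c T n v)"
        using grid_event_lower[OF assms(2) elim assms(1), of v e] by (simp add: v(2) R_def)
      then have "exp (- (b + e)) * R n \<le> exp (- (b + e)) * (exp (b + e) * prob (grid_event c T n v))"
        by (intro mult_left_mono) auto
      also have "\<dots> = prob (grid_event c T n v)"
        by (simp flip: mult.assoc exp_add)
      finally show ?case
        by (simp add: prob_compl)
    qed
    have "(\<lambda>n::nat. exp (- (c\<^sup>2 * T * n / 2))) \<longlonglongrightarrow> 0"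
      using assms(1,2) by real_asymp
    moreover have "(\<lambda>n::nat. (real n)\<^sup>2 * exp (b - sqrt n * e)
        * exp (2 * c\<^sup>2 * (T / n) * ((1 + sqrt n)\<^sup>2 - (1 + sqrt n)))) \<longlonglongrightarrow> 0"
      using assms(1-3) by real_asymp
    ultimately have "R \<longlonglongrightarrow> exp (2 * c\<^sup>2 * T * (1\<^sup>2 / 3 - 1 / 2)) - exp (- b) * exp (2 * c\<^sup>2 * T * (2\<^sup>2 / 3 - 2 / 2))
      - 0 - exp (b / 2) * (exp (2 * c\<^sup>2 * T * ((1 / 2)\<^sup>2 / 3 - (1 / 2) / 2)) * 0)"
      unfolding R_def[abs_def] by (intro tendsto_intros)
    then have "R \<longlonglongrightarrow> exp (- (c\<^sup>2 * T / 3)) - exp (- b) * exp (2 * c\<^sup>2 * T / 3)"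
      by (simp add: mult.commute[of T "c\<^sup>2"])
    then show "(\<lambda>n. 1 - exp (- (b + e)) * R n) \<longlonglongrightarrow> 1 - ?l"
      by (intro tendsto_intros)
  qed
  moreover have "1 - prob ?E \<le> prob (bounded_paths c - ?E) + prob (space M - bounded_paths c)"
  proof -
    have "1 - prob ?E = prob (space M - ?E)"
      by (simp add: prob_compl[OF E])
    also have "\<dots> \<le> prob ((bounded_paths c - ?E) \<union> (space M - bounded_paths c))"
      by (intro finite_measure_mono) auto
    also have "\<dots> \<le> prob (bounded_paths c - ?E) + prob (space M - bounded_paths c)"
      by (intro measure_Un_le) auto
    finally show ?thesis .
  qed
  ultimately show ?thesis
    using prob_unbounded_paths[OF assms(1)] by simp
qed

lemma workload_integral_lower_bound:
  assumes "c > 0" "T > 0" and b: "b = 2 * c * u / T"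
  shows "exp (- b) * (exp (- (c\<^sup>2 * T / 3)) - exp (- b) * exp (2 * c\<^sup>2 * T / 3))
    \<le> prob {\<omega>\<in>space M. u < (LBINT r:{0..T}. workload B c r \<omega>)}"
proof -
  define e where "e n = 1 / real (Suc n)" for n
  have "e \<longlonglongrightarrow> 0"
    unfolding e_def[abs_def] by real_asymp
  then have "(\<lambda>n. exp (- (b + e n + e n)) * (exp (- (c\<^sup>2 * T / 3)) - exp (- (b + e n)) * exp (2 * c\<^sup>2 * T / 3)))
     \<longlonglongrightarrow> exp (- (b + 0 + 0)) * (exp (- (c\<^sup>2 * T / 3)) - exp (- (b + 0)) * exp (2 * c\<^sup>2 * T / 3))"
    by (intro tendsto_intros)
  then have "exp (- (b + 0 + 0)) * (exp (- (c\<^sup>2 * T / 3)) - exp (- (b + 0)) * exp (2 * c\<^sup>2 * T / 3))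
    \<le> prob {\<omega>\<in>space M. u < (LBINT r:{0..T}. workload B c r \<omega>)}"
  proof (rule LIMSEQ_le_const2, intro exI allI impI)
    fix n
    show "exp (- (b + e n + e n)) * (exp (- (c\<^sup>2 * T / 3)) - exp (- (b + e n)) * exp (2 * c\<^sup>2 * T / 3))
      \<le> prob {\<omega>\<in>space M. u < (LBINT r:{0..T}. workload B c r \<omega>)}"
      by (rule workload_integral_lower_bound_eps) (use assms in \<open>auto simp: e_def\<close>)
  qed
  then show ?thesis by simp
qed

end

section \<open>Asymptotics as u tends to infinity\<close>

theorem theorem1:
  fixes M :: "'a measure" and B :: "real \<Rightarrow> 'a \<Rightarrow> real"
    and c :: real and T :: "real \<Rightarrow> real"
  assumes "two_sided_brownian_motion M B"
    and "c > 0"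
    and "\<And>u. T u > 0"
    and "T \<in> o[at_top](\<lambda>u. sqrt u)"
  shows "(\<lambda>u. measure M {\<omega> \<in> space M. (LBINT r:{0..T u}. workload B c r \<omega>) > u})
    \<sim>[at_top] (\<lambda>u. exp (- (2 * c * u / T u) - 1 / 3 * c\<^sup>2 * T u))"
proof -
  interpret two_sided_brownian_motion M B
    by (rule assms)
  define P where "P u = measure M {\<omega> \<in> space M. (LBINT r:{0..T u}. workload B c r \<omega>) > u}" for u
  define g where "g u = exp (- (2 * c * u / T u) - 1 / 3 * c\<^sup>2 * T u)" for u
  \<comment> \<open>With t = T u and y = u/t, eventually K t \<le> y. Since r \<ge> y/4, the
    Gaussian exponent r^2 / (2 t) is at least y^2 / (32 t) \<ge> (K/32) y = y + 3 c y. Here 3 c y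
    exceeds the exponent 2 c y + c^2 t / 3 of g, and the remaining y \<ge> sqrt u makes the error
    small relative to g.\<close>
  define K where "K = 32 + 96 * c"
  have "K > 0"
    using assms(2) by (simp add: K_def)
  have "eventually (\<lambda>u. norm (T u) \<le> 1 / sqrt K * norm (sqrt u)) at_top"
    by (rule landau_o.smallD[OF assms(4)]) (use \<open>K > 0\<close> in simp)
  then have bounds: "eventually (\<lambda>u. 1 - exp (- (c * sqrt u)) \<le> P u / g u \<and> P u / g u \<le> 1 + 2 * exp (- sqrt u)) at_top"
    using eventually_gt_at_top[of 0]
  proof eventually_elim
    case (elim u)
    define t where "t = T u"
    define y where "y = u / t"
    have t: "t > 0"
      using assms(3) by (simp add: t_def)
    have "t \<le> sqrt u / sqrt K"
      using elim t by (simp add: t_def)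
    then have "t * sqrt K \<le> sqrt u"
      using \<open>K > 0\<close> by (simp add: field_simps)
    then have "(t * sqrt K)\<^sup>2 \<le> (sqrt u)\<^sup>2"
      using t \<open>K > 0\<close> by (intro power_mono) auto
    then have "K * t\<^sup>2 \<le> u"
      using \<open>K > 0\<close> elim(2) by (simp add: power_mult_distrib mult.commute)
    then have y_K: "K * t \<le> y"
      using t by (simp add: y_def field_simps power2_eq_square)
    have "t \<le> t * sqrt K"
      using t assms(2) by (simp add: K_def)
    then have "t * sqrt u \<le> sqrt u * sqrt u"
      using \<open>t * sqrt K \<le> sqrt u\<close> elim(2) by (intro mult_right_mono) auto
    then have y_sqrt: "sqrt u \<le> y"
      using t elim(2) by (simp add: y_def field_simps)
    have "0 < sqrt u"
      using elim(2) by simp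
    then have y_pos: "y > 0"
      using y_sqrt by linarith
    have ct: "2 * (c * t) \<le> y"
    proof -
      have "(2 * c) * t \<le> K * t"
        using t assms(2) by (intro mult_right_mono) (auto simp: K_def)
      with y_K show ?thesis by simp
    qed
    have c2t: "c\<^sup>2 * t \<le> c * y / 2"
      using mult_left_mono[OF ct, of c] assms(2) by (simp add: power2_eq_square)
    have g: "g u = exp (- (2 * c * y)) * exp (- (c\<^sup>2 * t / 3))"
      by (simp add: g_def y_def t_def flip: exp_add)
    have "g u > 0"
      by (simp add: g_def)
    define r where "r = (y - c * t) / 2"
    have "r \<ge> y / 4"
      using ct by (simp add: r_def)
    then have "r > 0"
      using y_pos by linarith
    have "P u \<le> exp (- (2 * c * u / t)) * exp (- (c\<^sup>2 * t / 3)) + 2 * exp (- (r\<^sup>2 / (2 * t)))"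
      unfolding P_def t_def[symmetric] using assms(2) t _ \<open>r > 0\<close>
      by (rule workload_integral_upper_bound) (simp add: r_def y_def)
    then have upper: "P u \<le> g u + 2 * exp (- (r\<^sup>2 / (2 * t)))"
      by (simp add: g y_def)
    have "(y / 4)\<^sup>2 \<le> r\<^sup>2"
      using \<open>r \<ge> y / 4\<close> y_pos by (intro power_mono) auto
    then have "(y / 4)\<^sup>2 / (2 * t) \<le> r\<^sup>2 / (2 * t)"
      using t by (intro divide_right_mono) auto
    moreover have "K / 32 * y \<le> (y / 4)\<^sup>2 / (2 * t)"
      using mult_right_mono[OF y_K, of y] t y_pos by (simp add: field_simps power2_eq_square)
    ultimately have "K / 32 * y \<le> r\<^sup>2 / (2 * t)"
      by linarith
    moreover have "K / 32 * y = y + 3 * (c * y)"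
      by (simp add: K_def algebra_simps)
    moreover have "0 < c * y"
      using assms(2) y_pos by simp
    ultimately have "- (r\<^sup>2 / (2 * t)) \<le> - sqrt u + (- (2 * c * y) + - (c\<^sup>2 * t / 3))"
      using y_sqrt c2t by (simp add: mult.assoc)
    then have "exp (- (r\<^sup>2 / (2 * t))) \<le> exp (- sqrt u) * g u"
      unfolding g by (simp flip: exp_add)
    with upper have "P u \<le> (1 + 2 * exp (- sqrt u)) * g u"
      by (simp add: algebra_simps)
    moreover
    have "exp (- (2 * c * y)) * (exp (- (c\<^sup>2 * t / 3)) - exp (- (2 * c * y)) * exp (2 * c\<^sup>2 * t / 3)) \<le> P u"
      unfolding P_def t_def[symmetric] using assms(2) t
      by (rule workload_integral_lower_bound) (simp add: y_def)
    \<comment> \<open>Taking out exp (- c^2 t / 3) turns 2/3 into 2/3 + 1/3 = 1 in the subtracted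
      exponent.\<close>
    moreover have "exp (- (2 * c * y)) * (exp (- (c\<^sup>2 * t / 3)) - exp (- (2 * c * y)) * exp (2 * c\<^sup>2 * t / 3))
      = (1 - exp (- (2 * c * y) + c\<^sup>2 * t)) * g u"
      unfolding g by (simp add: algebra_simps flip: exp_add)
    moreover have "(1 - exp (- (c * sqrt u))) * g u \<le> (1 - exp (- (2 * c * y) + c\<^sup>2 * t)) * g u"
    proof -
      have "c * sqrt u \<le> c * y"
        using y_sqrt assms(2) by simp
      then have "- (2 * c * y) + c\<^sup>2 * t \<le> - (c * sqrt u)"
        using c2t \<open>0 < c * y\<close> by (simp add: mult.assoc)
      then show ?thesis
        using \<open>g u > 0\<close> by (intro mult_right_mono) auto
    qed
    ultimately have "(1 - exp (- (c * sqrt u))) * g u \<le> P u" "P u \<le> (1 + 2 * exp (- sqrt u)) * g u"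
      by linarith+
    then show ?case
      using \<open>g u > 0\<close> by (simp add: pos_le_divide_eq pos_divide_le_eq)
  qed
  have "((\<lambda>u. 1 - exp (- (c * sqrt u))) \<longlongrightarrow> 1) at_top"
    using assms(2) by real_asymp
  moreover have "((\<lambda>u::real. 1 + 2 * exp (- sqrt u)) \<longlongrightarrow> 1) at_top"
    by real_asymp
  ultimately have "((\<lambda>u. P u / g u) \<longlongrightarrow> 1) at_top"
    by (rule tendsto_sandwich[rotated 2]) (use bounds in \<open>auto elim: eventually_mono\<close>)
  then have "P \<sim>[at_top] g"
    by (rule asymp_equivI')
  then show ?thesis
    by (simp add: P_def[abs_def] g_def[abs_def])
qed

end
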